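(* Let $X$ be a proper geodesic metric space. Then $\partial_c^{\mathcal{FQ}}X$ is regular (a point and a closed set not containing it can be separated by disjoint open sets).
   Context: A function $\rho\colon[0,\infty)\to\mathbb{R}$ is sublinear if it is non-decreasing, eventually non-negative, and $\lim_{r\to\infty}\rho(r)/r=0$. Let $X$ be a proper geodesic metric space with metric $d$. For a closed subset $Z\subset X$ let $\pi_Z(x):=\{z\in Z\mid d(x,z)=d(x,Z)\}$. For sublinear $\rho$, $Z$ is $\rho$-contracting if for all $x,y\in X$: $d(x,y)\le d(x,Z)$ implies $\operatorname{diam}(\pi_Z(x)\cup\pi_Z(y))\le\rho(d(x,Z))$. $Z$ is contracting if it is $\rho$-contracting for some sublinear $\rho$. A geodesic is an isometric embedding of an interval. For $L\ge1$, $A\ge0$, an $(L,A)$-quasi-geodesic is a map $\gamma$ from an interval with $\frac1L|s-t|-A\le d(\gamma(s),\gamma(t))\le L|s-t|+A$ for all $s,t$; a ray has domain $[0,\infty)$. Quasi-geodesics are conflated with their images, and a quasi-geodesic is contracting if its image is. Fix a basepoint $o\in X$. $\partial_cX$ is the set of contracting quasi-geodesic rays based at $o$ modulo finite Hausdorff distance. Every $\zeta\in\partial_cX$ contains a geodesic ray based at $o$; the function $\rho_\zeta(r):=\sup\operatorname{diam}(\pi_\alpha(x)\cup\pi_\alpha(y))$, with supremum over geodesic rays $\alpha\in\zeta$ (based at $o$) and points $x,y$ with $d(x,y)\le d(x,\alpha)\le r$, is sublinear and every geodesic in $\zeta$ is $\rho_\zeta$-contracting. For each $\zeta$ fix a geodesic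 ray $\alpha^\zeta\in\zeta$. For sublinear $\rho$, $L\ge1$, $A\ge0$ set $\kappa(\rho,L,A):=\max\{3A,\,3L^2,\,1+\inf\{R>0\mid\forall r\ge R,\ 3L^2\rho(r)\le r\}\}$. For $r\ge1$, $U(\zeta,r)$ is the set of $\eta\in\partial_cX$ such that for all $L\ge1$, $A\ge0$ and every continuous $(L,A)$-quasi-geodesic ray $\beta\in\eta$ (based at $o$) we have $d(\beta,\{x\in\alpha^\zeta\mid d(x,o)\ge r\})\le\kappa(\rho_\zeta,L,A)$. The topology of fellow-travelling quasi-geodesics is $\mathcal{FQ}:=\{U\subset\partial_cX\mid\forall\zeta\in U\ \exists r\ge1,\ U(\zeta,r)\subset U\}$, and $\partial_c^{\mathcal{FQ}}X$ is $\partial_cX$ with this topology. *)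

theory Defs
  imports "HOL-Analysis.Analysis"
begin

definition sublinear :: "(real \<Rightarrow> real) \<Rightarrow> bool" where
  "sublinear \<rho> \<longleftrightarrow>
     mono_on {0..} \<rho> \<and> eventually (\<lambda>r. 0 \<le> \<rho> r) at_top \<and> ((\<lambda>r. \<rho> r / r) \<longlongrightarrow> 0) at_top"

definition closest_proj :: "'a::metric_space set \<Rightarrow> 'a \<Rightarrow> 'a set" where
  "closest_proj Z x = {z \<in> Z. dist x z = infdist x Z}"

text \<open>
  Closedness is part of the definition, not a convenience: for a non-closed set the projections may
  all be empty away from the set, and the inequality would then hold vacuously.
\<close>

definition contracting_with :: "(real \<Rightarrow> real) \<Rightarrow> 'a::metric_space set \<Rightarrow> bool" where
  "contracting_with \<rho> Z \<longleftrightarrow> closed Z \<and>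
     (\<forall>x y. dist x y \<le> infdist x Z \<longrightarrow>
        diameter (closest_proj Z x \<union> closest_proj Z y) \<le> \<rho> (infdist x Z))"

definition contracting :: "'a::metric_space set \<Rightarrow> bool" where
  "contracting Z \<longleftrightarrow> (\<exists>\<rho>. sublinear \<rho> \<and> contracting_with \<rho> Z)"

text \<open>
  Maps on an interval are total functions on \<^typ>\<open>real\<close>, of which only the values on the
  interval matter.
\<close>

definition geodesic_on :: "real set \<Rightarrow> (real \<Rightarrow> 'a::metric_space) \<Rightarrow> bool" where
  "geodesic_on I \<gamma> \<longleftrightarrow> (\<forall>s\<in>I. \<forall>t\<in>I. dist (\<gamma> s) (\<gamma> t) = \<bar>s - t\<bar>)"

definition quasi_geodesic_on ::
    "real \<Rightarrow> real \<Rightarrow> real set \<Rightarrow> (real \<Rightarrow> 'a::metric_space) \<Rightarrow> bool" where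
  "quasi_geodesic_on L A I \<gamma> \<longleftrightarrow>
     (\<forall>s\<in>I. \<forall>t\<in>I. 1 / L * \<bar>s - t\<bar> - A \<le> dist (\<gamma> s) (\<gamma> t) \<and>
                   dist (\<gamma> s) (\<gamma> t) \<le> L * \<bar>s - t\<bar> + A)"

definition geodesic_space :: "'a::metric_space set \<Rightarrow> bool" where
  "geodesic_space X \<longleftrightarrow>
     (\<forall>x\<in>X. \<forall>y\<in>X. \<exists>l\<ge>0. \<exists>\<gamma>. geodesic_on {0..l} \<gamma> \<and> \<gamma> ` {0..l} \<subseteq> X \<and> \<gamma> 0 = x \<and> \<gamma> l = y)"

definition finite_hausdorff_dist :: "'a::metric_space set \<Rightarrow> 'a set \<Rightarrow> bool" where
  "finite_hausdorff_dist S T \<longleftrightarrow>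
     (\<exists>C. (\<forall>x\<in>S. \<exists>y\<in>T. dist x y \<le> C) \<and> (\<forall>y\<in>T. \<exists>x\<in>S. dist x y \<le> C))"

definition contracting_rays :: "'a::metric_space \<Rightarrow> (real \<Rightarrow> 'a) set" where
  "contracting_rays bp =
     {\<gamma>. \<gamma> 0 = bp \<and> (\<exists>L\<ge>1. \<exists>A\<ge>0. quasi_geodesic_on L A {0..} \<gamma>) \<and> contracting (\<gamma> ` {0..})}"

definition ray_rel :: "'a::metric_space \<Rightarrow> ((real \<Rightarrow> 'a) \<times> (real \<Rightarrow> 'a)) set" where
  "ray_rel bp = {(\<gamma>, \<gamma>'). \<gamma> \<in> contracting_rays bp \<and> \<gamma>' \<in> contracting_rays bp \<and>
                          finite_hausdorff_dist (\<gamma> ` {0..}) (\<gamma>' ` {0..})}"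

definition contracting_boundary :: "'a::metric_space \<Rightarrow> (real \<Rightarrow> 'a) set set" where
  "contracting_boundary bp = contracting_rays bp // ray_rel bp"

text \<open>
  For \<open>r \<ge> 0\<close> and a boundary point \<open>\<zeta>\<close> the supremum is over a non-empty set bounded by \<open>4 * r\<close>,
  so it is a genuine supremum; values at negative \<open>r\<close> are never used.
\<close>

definition rho_class :: "(real \<Rightarrow> 'a::metric_space) set \<Rightarrow> real \<Rightarrow> real" where
  "rho_class \<zeta> r =
     Sup {diameter (closest_proj (\<alpha> ` {0..}) x \<union> closest_proj (\<alpha> ` {0..}) y) | \<alpha> x y.
            \<alpha> \<in> \<zeta> \<and> geodesic_on {0..} \<alpha> \<and>
            dist x y \<le> infdist x (\<alpha> ` {0..}) \<and> infdist x (\<alpha> ` {0..}) \<le> r}"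

definition kappa :: "(real \<Rightarrow> real) \<Rightarrow> real \<Rightarrow> real \<Rightarrow> real" where
  "kappa \<rho> L A =
     Max {3 * A, 3 * L^2, 1 + Inf {R. R > 0 \<and> (\<forall>r\<ge>R. 3 * L^2 * \<rho> r \<le> r)}}"

definition geodesic_choice ::
    "'a::metric_space \<Rightarrow> ((real \<Rightarrow> 'a) set \<Rightarrow> real \<Rightarrow> 'a) \<Rightarrow> bool" where
  "geodesic_choice bp \<alpha> \<longleftrightarrow>
     (\<forall>\<zeta>\<in>contracting_boundary bp. \<alpha> \<zeta> \<in> \<zeta> \<and> geodesic_on {0..} (\<alpha> \<zeta>))"

definition FQ_nbhd ::
    "'a::metric_space \<Rightarrow> ((real \<Rightarrow> 'a) set \<Rightarrow> real \<Rightarrow> 'a) \<Rightarrow> (real \<Rightarrow> 'a) set \<Rightarrow> real \<Rightarrow>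
     (real \<Rightarrow> 'a) set set" where
  "FQ_nbhd bp \<alpha> \<zeta> r =
     {\<eta> \<in> contracting_boundary bp.
        \<forall>L\<ge>1. \<forall>A\<ge>0. \<forall>\<beta>\<in>\<eta>. continuous_on {0..} \<beta> \<and> quasi_geodesic_on L A {0..} \<beta> \<longrightarrow>
          setdist (\<beta> ` {0..}) {x \<in> \<alpha> \<zeta> ` {0..}. r \<le> dist x bp} \<le> kappa (rho_class \<zeta>) L A}"

definition FQ_topology ::
    "'a::metric_space \<Rightarrow> ((real \<Rightarrow> 'a) set \<Rightarrow> real \<Rightarrow> 'a) \<Rightarrow> (real \<Rightarrow> 'a) set topology" where
  "FQ_topology bp \<alpha> =
     topology (\<lambda>U. U \<subseteq> contracting_boundary bp \<and> (\<forall>\<zeta>\<in>U. \<exists>r\<ge>1. FQ_nbhd bp \<alpha> \<zeta> r \<subseteq> U))"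

text \<open>
  The family in \<open>FQ_topology\<close> is closed under finite intersections and arbitrary unions, so that
  \<^const>\<open>topology\<close> yields the intended open sets.
\<close>

lemma FQ_nbhd_antimono:
  assumes ch: "geodesic_choice bp \<alpha>" and z: "\<zeta> \<in> contracting_boundary bp"
    and rs: "1 \<le> r" "r \<le> s"
  shows "FQ_nbhd bp \<alpha> \<zeta> s \<subseteq> FQ_nbhd bp \<alpha> \<zeta> r"
proof -
  have "\<alpha> \<zeta> \<in> \<zeta>" and g: "geodesic_on {0..} (\<alpha> \<zeta>)"
    using ch z by (auto simp: geodesic_choice_def)
  then have "\<alpha> \<zeta> 0 = bp"
    using z by (auto simp: contracting_boundary_def quotient_def ray_rel_def contracting_rays_def)
  moreover have "dist (\<alpha> \<zeta> s) (\<alpha> \<zeta> 0) = s"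
    using g rs by (auto simp: geodesic_on_def)
  ultimately have "\<alpha> \<zeta> s \<in> {x \<in> \<alpha> \<zeta> ` {0..}. s \<le> dist x bp}"
    using rs by auto
  then have ne: "{x \<in> \<alpha> \<zeta> ` {0..}. s \<le> dist x bp} \<noteq> {}" by blast
  have sub: "{x \<in> \<alpha> \<zeta> ` {0..}. s \<le> dist x bp} \<subseteq> {x \<in> \<alpha> \<zeta> ` {0..}. r \<le> dist x bp}"
    using rs by auto
  have "setdist B {x \<in> \<alpha> \<zeta> ` {0..}. r \<le> dist x bp} \<le> setdist B {x \<in> \<alpha> \<zeta> ` {0..}. s \<le> dist x bp}" for B
    by (rule setdist_subset_right[OF ne sub])
  then show ?thesis
    unfolding FQ_nbhd_def by (blast intro: order_trans)
qed

lemma openin_FQ_topology: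
  assumes ch: "geodesic_choice bp \<alpha>"
  shows "openin (FQ_topology bp \<alpha>) U \<longleftrightarrow>
    U \<subseteq> contracting_boundary bp \<and> (\<forall>\<zeta>\<in>U. \<exists>r\<ge>1. FQ_nbhd bp \<alpha> \<zeta> r \<subseteq> U)"
proof -
  let ?P = "\<lambda>U. U \<subseteq> contracting_boundary bp \<and> (\<forall>\<zeta>\<in>U. \<exists>r\<ge>1. FQ_nbhd bp \<alpha> \<zeta> r \<subseteq> U)"
  have int: "?P (S \<inter> T)" if S: "?P S" and T: "?P T" for S T
  proof (intro conjI ballI)
    show "S \<inter> T \<subseteq> contracting_boundary bp" using S by blast
    fix \<zeta> assume z: "\<zeta> \<in> S \<inter> T"
    obtain r where r: "r \<ge> 1" "FQ_nbhd bp \<alpha> \<zeta> r \<subseteq> S" using S z by blast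
    obtain s where s: "s \<ge> 1" "FQ_nbhd bp \<alpha> \<zeta> s \<subseteq> T" using T z by blast
    have zb: "\<zeta> \<in> contracting_boundary bp" using S z by blast
    have "FQ_nbhd bp \<alpha> \<zeta> (max r s) \<subseteq> S" "FQ_nbhd bp \<alpha> \<zeta> (max r s) \<subseteq> T"
      using FQ_nbhd_antimono[OF ch zb r(1), of "max r s"] r(2)
        FQ_nbhd_antimono[OF ch zb s(1), of "max r s"] s(2) by auto
    then have "FQ_nbhd bp \<alpha> \<zeta> (max r s) \<subseteq> S \<inter> T" by blast
    moreover have "max r s \<ge> 1" using r(1) by simp
    ultimately show "\<exists>r\<ge>1. FQ_nbhd bp \<alpha> \<zeta> r \<subseteq> S \<inter> T" by blast
  qed
  have un: "?P (\<Union>\<K>)" if K: "\<forall>K\<in>\<K>. ?P K" for \<K>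
  proof (intro conjI ballI)
    show "\<Union>\<K> \<subseteq> contracting_boundary bp" using K by blast
    fix \<zeta> assume "\<zeta> \<in> \<Union>\<K>"
    then obtain K where k: "K \<in> \<K>" "\<zeta> \<in> K" by blast
    then obtain r where "r \<ge> 1" "FQ_nbhd bp \<alpha> \<zeta> r \<subseteq> K" using K by blast
    with k show "\<exists>r\<ge>1. FQ_nbhd bp \<alpha> \<zeta> r \<subseteq> \<Union>\<K>" by blast
  qed
  have "istopology ?P"
    unfolding istopology_def using int un by simp
  then show ?thesis
    unfolding FQ_topology_def by (simp add: topology_inverse')
qed

lemma topspace_FQ_topology:
  assumes "geodesic_choice bp \<alpha>"
  shows "topspace (FQ_topology bp \<alpha>) = contracting_boundary bp"
proof
  show "topspace (FQ_topology bp \<alpha>) \<subseteq> contracting_boundary bp"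
    using openin_FQ_topology[OF assms] openin_topspace by blast
  have "FQ_nbhd bp \<alpha> \<zeta> 1 \<subseteq> contracting_boundary bp" for \<zeta>
    by (auto simp: FQ_nbhd_def)
  then have "openin (FQ_topology bp \<alpha>) (contracting_boundary bp)"
    unfolding openin_FQ_topology[OF assms] by blast
  then show "contracting_boundary bp \<subseteq> topspace (FQ_topology bp \<alpha>)"
    by (rule openin_subset)
qed

end

theory Submission
  imports Defs
begin

text \<open>
  Write \<open>\<alpha> \<zeta>\<close> for the chosen ray of \<open>\<zeta>\<close>. A continuous quasi-geodesic that stays
  \<open>kappa\<close>-far from a contracting set can do so only for a time bounded by its distances at the two
  ends; hence passing near \<open>\<alpha> \<zeta>\<close> far out improves to passing \<open>kappa\<close>-near it not much earlier.

  If a quasi-geodesic ray \<open>\<beta>\<close> comes, arbitrarily far out, within some distance \<open>J\<close> of \<open>\<alpha> \<theta>\<close>, it can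
  be followed for a long time and then be left for \<open>\<alpha> \<theta>\<close> so that the constants of the resulting
  quasi-geodesic in \<open>\<theta>\<close> do not depend on \<open>J\<close>. Thus for \<open>\<theta> \<in> U(\<zeta>, R)\<close>, with \<open>R\<close> depending
  on \<open>\<zeta>\<close> and \<open>r\<close> only, \<open>\<beta>\<close> satisfies the condition of \<open>U(\<zeta>, r)\<close>. With \<open>\<beta>\<close> in a class of
  \<open>U(\<theta>, R')\<close> this makes every \<open>U(\<zeta>, r)\<close> a neighbourhood of \<open>\<zeta>\<close>; with \<open>\<beta>\<close> witnessing
  \<open>\<eta> \<notin> U(\<zeta>, r)\<close> and \<open>\<theta> \<in> U(\<eta>, R') \<inter> U(\<zeta>, R)\<close> it is a contradiction, so these sets are disjoint.
\<close>

section \<open>Quasi-geodesics and contracting sets\<close>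

lemma closest_proj_nonempty:
  fixes Z :: "'a::heine_borel set"
  assumes "closed Z" "Z \<noteq> {}"
  obtains z where "z \<in> closest_proj Z x"
proof -
  obtain z where "z \<in> Z" "infdist x Z = dist x z" using infdist_attains_inf[OF assms] .
  then show thesis using that by (simp add: closest_proj_def)
qed

lemma closest_projD:
  assumes "z \<in> closest_proj Z x"
  shows "z \<in> Z" "dist x z = infdist x Z"
  using assms by (auto simp: closest_proj_def)

lemma bounded_closest_proj: "bounded (closest_proj Z x)"
  by (rule bounded_subset[of "cball x (infdist x Z)"]) (auto simp: closest_proj_def)

lemma contracting_with_dist_le:
  assumes "contracting_with \<rho> Z" "dist x y \<le> infdist x Z"
    and "p \<in> closest_proj Z x \<union> closest_proj Z y" "q \<in> closest_proj Z x \<union> closest_proj Z y"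
  shows "dist p q \<le> \<rho> (infdist x Z)"
proof -
  have "dist p q \<le> diameter (closest_proj Z x \<union> closest_proj Z y)"
    using assms(3,4) by (intro diameter_bounded_bound) (auto simp: bounded_closest_proj)
  then show ?thesis using assms(1,2) unfolding contracting_with_def by fastforce
qed

lemma quasi_geodesic_onD:
  assumes "quasi_geodesic_on L A I \<gamma>" "s \<in> I" "t \<in> I" "s \<le> t"
  shows "(t - s) / L - A \<le> dist (\<gamma> s) (\<gamma> t)" "dist (\<gamma> s) (\<gamma> t) \<le> L * (t - s) + A"
  using assms unfolding quasi_geodesic_on_def by force+

text \<open>
  Jump along \<open>\<beta>\<close> by steps whose length is the current distance to \<open>Z\<close>. Each step moves the
  projection by at most \<open>\<rho>\<close> of that distance, a \<open>1 / (3 * L\<^sup>2)\<close>-fraction of it, while it costs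
  at least a \<open>2 / (3 * L)\<close>-fraction in time; as \<open>\<beta>\<close> is a quasi-geodesic the time is bounded.
\<close>

lemma quasi_geodesic_excursion_bound:
  fixes Z :: "'a::heine_borel set"
  assumes con: "contracting_with \<rho> Z" and ne: "Z \<noteq> {}"
    and L: "1 \<le> L" and A: "0 \<le> A" and ab: "a \<le> b"
    and cont: "continuous_on {a..b} \<beta>" and qg: "quasi_geodesic_on L A {a..b} \<beta>"
    and K: "0 < K" "3 * A \<le> K" "\<And>r. K \<le> r \<Longrightarrow> 3 * L\<^sup>2 * \<rho> r \<le> r"
    and far: "\<And>t. t \<in> {a..b} \<Longrightarrow> K \<le> infdist (\<beta> t) Z"
  shows "b - a \<le> 3 * L * (A + infdist (\<beta> a) Z + infdist (\<beta> b) Z)"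
proof -
  define f where "f t = infdist (\<beta> t) Z" for t
  have cl: "closed Z" using con by (simp add: contracting_with_def)
  obtain p where p: "p \<in> closest_proj Z (\<beta> a)" using closest_proj_nonempty[OF cl ne] .
  \<comment> \<open>\<open>Q\<close> is the sum of the step lengths so far. It bounds
    \<open>3 * L\<^sup>2\<close> times the shift of the projection, and a step of length
    \<open>f s\<close> takes time at least \<open>2 * f s / (3 * L)\<close>. Either the jumping has
    stopped, the rest of \<beta> lying within \<open>f s\<close> of \<open>\<beta> s\<close>, or the
    time of \<open>n\<close> steps of length \<open>K\<close> has passed.\<close>
  have ex: "\<exists>s Q q. s \<in> {a..b} \<and> q \<in> closest_proj Z (\<beta> s) \<and>
      2 * Q \<le> 3 * L * (s - a) \<and> 3 * L\<^sup>2 * dist p q \<le> Q \<and>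
      ((\<forall>t\<in>{s..b}. dist (\<beta> s) (\<beta> t) \<le> f s) \<or> real n * (2 * K) \<le> 3 * L * (s - a))" for n
  proof (induction n)
    case 0
    show ?case using p ab by (intro exI[of _ a] exI[of _ 0] exI[of _ p]) auto
  next
    case (Suc n)
    then obtain s Q q where s: "s \<in> {a..b}" "q \<in> closest_proj Z (\<beta> s)"
      "2 * Q \<le> 3 * L * (s - a)" "3 * L\<^sup>2 * dist p q \<le> Q"
      and alt: "(\<forall>t\<in>{s..b}. dist (\<beta> s) (\<beta> t) \<le> f s) \<or> real n * (2 * K) \<le> 3 * L * (s - a)"
      by blast
    show ?case
    proof (cases "\<forall>t\<in>{s..b}. dist (\<beta> s) (\<beta> t) \<le> f s")
      case True
      then show ?thesis using s by blast
    next
      case False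
      with alt have n: "real n * (2 * K) \<le> 3 * L * (s - a)" by blast
      \<comment> \<open>The next jump ends at distance exactly \<open>f s\<close>, the longest step
        for which contraction compares the projections.\<close>
      obtain t where t: "t \<in> {s..b}" "f s < dist (\<beta> s) (\<beta> t)" using False by force
      have "continuous_on {s..t} (\<lambda>t. dist (\<beta> s) (\<beta> t))"
        using s(1) t(1) by (intro continuous_intros continuous_on_subset[OF cont]) auto
      then obtain t' where t': "s \<le> t'" "t' \<le> t" "dist (\<beta> s) (\<beta> t') = f s"
        using IVT'[of "\<lambda>t. dist (\<beta> s) (\<beta> t)" s "f s" t] t by (auto simp: f_def infdist_nonneg)
      obtain q' where q': "q' \<in> closest_proj Z (\<beta> t')" using closest_proj_nonempty[OF cl ne] .
      have fs: "K \<le> f s" using far s(1) by (simp add: f_def)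
      have "dist q q' \<le> \<rho> (f s)"
        using contracting_with_dist_le[OF con, of "\<beta> s" "\<beta> t'" q q'] s(2) q' t'(3)
        by (simp add: f_def)
      then have "3 * L\<^sup>2 * dist q q' \<le> 3 * L\<^sup>2 * \<rho> (f s)"
        by (intro mult_left_mono) auto
      also have "\<dots> \<le> f s" using K(3) fs by blast
      finally have qq: "3 * L\<^sup>2 * dist q q' \<le> f s" .
      have "3 * L\<^sup>2 * dist p q' \<le> 3 * L\<^sup>2 * (dist p q + dist q q')"
        by (intro mult_left_mono dist_triangle) auto
      then have 1: "3 * L\<^sup>2 * dist p q' \<le> Q + f s" using s(4) qq by (simp add: distrib_left)
      \<comment> \<open>As \<open>3 * A \<le> K \<le> f s\<close>, the additive constant takes at
        most a third of the step.\<close>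
      have "f s \<le> L * (t' - s) + A"
        using quasi_geodesic_onD(2)[OF qg, of s t'] s(1) t t' by auto
      then have 2: "2 * f s \<le> 3 * L * (t' - s)" using fs K(2) by simp
      have "3 * L * (t' - a) = 3 * L * (s - a) + 3 * L * (t' - s)" by (simp add: algebra_simps)
      then have "2 * (Q + f s) \<le> 3 * L * (t' - a)" "real (Suc n) * (2 * K) \<le> 3 * L * (t' - a)"
        using s(3) n 2 fs by (simp_all add: distrib_right)
      then show ?thesis
        using 1 q' s(1) t(1) t'(1,2)
        by (intro exI[of _ t'] exI[of _ "Q + f s"] exI[of _ q']) auto
    qed
  qed
  \<comment> \<open>This many steps would last longer than \<open>b - a\<close>, so the first
    alternative holds and one more comparison of projections reaches
    \<open>\<beta> b\<close>.\<close>
  obtain n where "3 * L * (b - a) / (2 * K) < real n" using reals_Archimedean2 by blast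
  then have n: "3 * L * (b - a) < real n * (2 * K)" using K(1) by (simp add: field_simps)
  obtain s Q q where s: "s \<in> {a..b}" "q \<in> closest_proj Z (\<beta> s)"
    "2 * Q \<le> 3 * L * (s - a)" "3 * L\<^sup>2 * dist p q \<le> Q"
    and alt: "(\<forall>t\<in>{s..b}. dist (\<beta> s) (\<beta> t) \<le> f s) \<or> real n * (2 * K) \<le> 3 * L * (s - a)"
    using ex[of n] by blast
  have "3 * L * (s - a) \<le> 3 * L * (b - a)" using s(1) L by (intro mult_left_mono) auto
  then have near: "dist (\<beta> s) (\<beta> b) \<le> f s" using alt n s(1) by auto
  obtain q' where q': "q' \<in> closest_proj Z (\<beta> b)" using closest_proj_nonempty[OF cl ne] .
  have "dist q q' \<le> \<rho> (f s)"
    using contracting_with_dist_le[OF con, of "\<beta> s" "\<beta> b" q q'] s(2) q' near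
    by (simp add: f_def)
  then have "3 * L\<^sup>2 * dist q q' \<le> 3 * L\<^sup>2 * \<rho> (f s)"
    by (intro mult_left_mono) auto
  also have "\<dots> \<le> f s" using K(3) far s(1) by (auto simp: f_def)
  finally have qq: "3 * L\<^sup>2 * dist q q' \<le> f s" .
  have d: "dist (\<beta> a) (\<beta> b) \<le> f a + dist p q + dist q q' + f b"
    using closest_projD(2)[OF p] closest_projD(2)[OF q'] dist_triangle[of "\<beta> a" "\<beta> b" p]
      dist_triangle[of p "\<beta> b" q] dist_triangle[of q "\<beta> b" q'] dist_commute[of q' "\<beta> b"]
    by (simp add: f_def)
  have "(b - a) / L \<le> A + f a + f b + dist p q + dist q q'"
    using quasi_geodesic_onD(1)[OF qg, of a b] ab d by simp
  then have "3 * L\<^sup>2 * ((b - a) / L) \<le> 3 * L\<^sup>2 * (A + f a + f b + dist p q + dist q q')"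
    by (intro mult_left_mono) auto
  also have "3 * L\<^sup>2 * ((b - a) / L) = 3 * L * (b - a)"
    using L by (simp add: power2_eq_square)
  also have "3 * L\<^sup>2 * (A + f a + f b + dist p q + dist q q') \<le> 3 * L\<^sup>2 * (A + f a + f b) + Q + f s"
    using s(4) qq unfolding distrib_left by linarith
  finally have m: "3 * L * (b - a) \<le> 3 * L\<^sup>2 * (A + f a + f b) + Q + f s" .
  have "f s \<le> f b + dist (\<beta> s) (\<beta> b)" unfolding f_def by (rule infdist_triangle)
  also have "dist (\<beta> s) (\<beta> b) \<le> L * (b - s) + A"
    using quasi_geodesic_onD(2)[OF qg, of s b] s(1) by auto
  finally have fs: "f s \<le> f b + L * (b - s) + A" by simp
  have nn: "0 \<le> L * (b - s)" "0 \<le> f a" "0 \<le> f b"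
    using L s(1) by (auto simp: f_def infdist_nonneg)
  have eq: "L * (b - a) = L * (s - a) + L * (b - s)" by (simp add: algebra_simps)
  have W: "A + f a + f b \<le> L\<^sup>2 * (A + f a + f b)"
    using mult_right_mono[of 1 "L\<^sup>2" "A + f a + f b"] L A nn by simp
  \<comment> \<open>With \<open>X = L * (b - a)\<close>, the terms \<open>Q\<close> and
    \<open>f s\<close> together are at most \<open>3 / 2 * X + S\<close>, which leaves
    \<open>3 / 2 * X \<le> 4 * S\<close>. Variables replace the products so that the claim is
    linear.\<close>
  have arith: "X \<le> 3 * S" if "A + f a + f b \<le> S" "3 * X \<le> 3 * S + Q + f s" "2 * Q \<le> 3 * Y"
    "f s \<le> f b + V + A" "0 \<le> V" "X = Y + V" for X Y V S
    using that nn A by linarith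
  have "3 * (L * (b - a)) \<le> 3 * (L\<^sup>2 * (A + f a + f b)) + Q + f s"
    using m by (simp only: mult.assoc)
  moreover have "2 * Q \<le> 3 * (L * (s - a))" using s(3) by (simp only: mult.assoc)
  ultimately have "L * (b - a) \<le> 3 * (L\<^sup>2 * (A + f a + f b))"
    using arith[OF W _ _ fs nn(1) eq] by blast
  also have "\<dots> = L * (3 * L * (A + f a + f b))" by (simp add: power2_eq_square)
  finally show ?thesis using L unfolding f_def by simp
qed

text \<open>By compactness \<open>f t = c\<close> has a last solution; a smaller value afterwards
  would give a later one. Such times start the maximal excursions away from a contracting
  set.\<close>

lemma IVT_last_exit:
  fixes f :: "real \<Rightarrow> real"
  assumes "a \<le> b" "continuous_on {a..b} f" "f a \<le> c" "c \<le> f b"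
  obtains t where "t \<in> {a..b}" "f t = c" "\<And>s. s \<in> {t..b} \<Longrightarrow> c \<le> f s"
proof -
  let ?S = "{t \<in> {a..b}. f t = c}"
  have "closed ?S" by (rule continuous_closed_preimage_constant[OF assms(2) closed_atLeastAtMost])
  then have "compact ({a..b} \<inter> ?S)" by (rule compact_Int_closed[OF compact_Icc])
  moreover have "{a..b} \<inter> ?S = ?S" by blast
  ultimately have "compact ?S" by (simp only:)
  moreover have "?S \<noteq> {}" using IVT'[OF assms(3,4,1,2)] by force
  ultimately obtain t where t: "t \<in> ?S" "\<And>s. s \<in> ?S \<Longrightarrow> s \<le> t"
    using compact_attains_sup[of ?S] by (metis (no_types, lifting))
  have "c \<le> f s" if s: "s \<in> {t..b}" for s
  proof (rule ccontr)
    assume "\<not> c \<le> f s"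
    moreover have "continuous_on {s..b} f"
      using s t(1) by (intro continuous_on_subset[OF assms(2)]) auto
    ultimately obtain x where x: "s \<le> x" "x \<le> b" "f x = c"
      using IVT'[of f s c b] assms(4) s by (metis atLeastAtMost_iff linorder_linear)
    have "a \<le> x" using x(1) s t(1) by simp
    then have "x \<le> t" using t(2)[of x] x by simp
    then have "x = s" using x(1) s by simp
    then show False using x(3) \<open>\<not> c \<le> f s\<close> by simp
  qed
  then show thesis using that t(1) by blast
qed

lemma IVT_first_entry:
  fixes f :: "real \<Rightarrow> real"
  assumes "a \<le> b" "continuous_on {a..b} f" "f b \<le> c" "c \<le> f a"
  obtains t where "t \<in> {a..b}" "f t = c" "\<And>s. s \<in> {a..t} \<Longrightarrow> c \<le> f s"
proof -
  have "continuous_on {-b..-a} (\<lambda>t. f (- t))"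
    by (intro continuous_on_compose2[OF assms(2)] continuous_on_minus continuous_on_id) auto
  moreover have "f (- (- b)) \<le> c" "c \<le> f (- (- a))" "-b \<le> -a" using assms by simp_all
  ultimately obtain t where t: "t \<in> {-b..-a}" "f (- t) = c" "\<And>s. s \<in> {t..-a} \<Longrightarrow> c \<le> f (- s)"
    using IVT_last_exit[of "-b" "-a" "\<lambda>t. f (- t)" c] by blast
  have "c \<le> f s" if "s \<in> {a..-t}" for s using t(3)[of "- s"] that by simp
  moreover have "- t \<in> {a..b}" using t(1) by simp
  ultimately show thesis using that[of "- t"] t(2) by blast
qed

lemma quasi_geodesic_on_subset:
  assumes "quasi_geodesic_on L A I \<gamma>" "J \<subseteq> I"
  shows "quasi_geodesic_on L A J \<gamma>"
  using assms unfolding quasi_geodesic_on_def by blast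

text \<open>A point farther than \<open>K\<close> from \<open>Z\<close> lies on an excursion with
  both ends at distance exactly \<open>K\<close>. This excursion lasts at most
  \<open>3 * L * (A + 2 * K)\<close>, which limits the displacement from its start.\<close>

lemma quasi_geodesic_near_contracting:
  fixes Z :: "'a::heine_borel set"
  assumes con: "contracting_with \<rho> Z" and ne: "Z \<noteq> {}"
    and L: "1 \<le> L" and A: "0 \<le> A"
    and cont: "continuous_on {a..b} \<beta>" and qg: "quasi_geodesic_on L A {a..b} \<beta>"
    and K: "0 < K" "3 * A \<le> K" "\<And>r. K \<le> r \<Longrightarrow> 3 * L\<^sup>2 * \<rho> r \<le> r"
    and ends: "infdist (\<beta> a) Z \<le> K" "infdist (\<beta> b) Z \<le> K" and t: "t \<in> {a..b}"
  shows "infdist (\<beta> t) Z \<le> K + A + 3 * L\<^sup>2 * (A + 2 * K)"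
proof (cases "infdist (\<beta> t) Z \<le> K")
  case True
  moreover have "0 \<le> 3 * L\<^sup>2 * (A + 2 * K)" using A K L by simp
  ultimately show ?thesis using A by linarith
next
  case False
  let ?f = "\<lambda>t. infdist (\<beta> t) Z"
  have c: "continuous_on {a..b} ?f" using cont by (intro continuous_intros)
  have "continuous_on {a..t} ?f" "continuous_on {t..b} ?f"
    using t by (auto intro: continuous_on_subset[OF c])
  moreover have "a \<le> t" "t \<le> b" "K \<le> ?f t" using t False by auto
  ultimately obtain u v where u: "u \<in> {a..t}" "?f u = K" "\<And>s. s \<in> {u..t} \<Longrightarrow> K \<le> ?f s"
    and v: "v \<in> {t..b}" "?f v = K" "\<And>s. s \<in> {t..v} \<Longrightarrow> K \<le> ?f s"
    using IVT_last_exit[of a t ?f K, OF _ _ ends(1)] IVT_first_entry[of t b ?f K, OF _ _ ends(2)]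
    by metis
  have far: "K \<le> ?f s" if "s \<in> {u..v}" for s
    using u(3)[of s] v(3)[of s] that by (cases "s \<le> t") auto
  have sub: "{u..v} \<subseteq> {a..b}" and "u \<le> v" using u(1) v(1) by auto
  then have "v - u \<le> 3 * L * (A + ?f u + ?f v)"
    using quasi_geodesic_excursion_bound[OF con ne L A _ continuous_on_subset[OF cont sub]
        quasi_geodesic_on_subset[OF qg sub] K far] by blast
  moreover have "t \<le> v" using v(1) by simp
  moreover have "A + ?f u + ?f v = A + 2 * K" using u(2) v(2) by simp
  ultimately have "v - u \<le> 3 * L * (A + 2 * K)" by (simp only:)
  with \<open>t \<le> v\<close> have uv: "t - u \<le> 3 * L * (A + 2 * K)" by linarith
  have "?f t \<le> ?f u + dist (\<beta> t) (\<beta> u)" by (rule infdist_triangle)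
  also have "dist (\<beta> t) (\<beta> u) \<le> L * (t - u) + A"
    using quasi_geodesic_onD(2)[OF qg, of u t] u(1) t by (simp add: dist_commute)
  also have "L * (t - u) \<le> L * (3 * L * (A + 2 * K))" using uv L by (intro mult_left_mono) auto
  finally show ?thesis unfolding u(2) by (simp add: power2_eq_square)
qed

text \<open>If \<open>\<beta> T\<close> is not yet \<open>K\<close>-close to \<alpha>, go back to
  the last time before \<open>T\<close> at distance \<open>K\<close>. The excursion in between has
  end distances at most \<open>K\<close> and \<open>J\<close>, so it is short, and the lower bound
  on \<open>u\<close> outweighs the resulting loss along \<alpha>.\<close>

lemma quasi_geodesic_close_improve:
  fixes \<alpha> \<beta> :: "real \<Rightarrow> 'a::heine_borel"
  assumes con: "contracting_with \<rho> (\<alpha> ` {0..})" and geo: "geodesic_on {0..} \<alpha>"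
    and L: "1 \<le> L" and A: "0 \<le> A" and start: "\<beta> 0 = \<alpha> 0"
    and cont: "continuous_on {0..} \<beta>" and qg: "quasi_geodesic_on L A {0..} \<beta>"
    and K: "0 < K" "3 * A \<le> K" "\<And>r. K \<le> r \<Longrightarrow> 3 * L\<^sup>2 * \<rho> r \<le> r"
    and T: "0 \<le> T" and u: "0 \<le> u" and close: "dist (\<beta> T) (\<alpha> u) \<le> J"
    and R: "r + J + K + A + 3 * L\<^sup>2 * (A + K + J) \<le> u"
  obtains t v where "0 \<le> t" "0 \<le> v" "r \<le> v" "dist (\<beta> t) (\<alpha> v) \<le> K"
proof -
  let ?Z = "\<alpha> ` {0..}"
  let ?f = "\<lambda>t. infdist (\<beta> t) ?Z"
  have ne: "?Z \<noteq> {}" and cl: "closed ?Z" using con by (auto simp: contracting_with_def)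
  have fT: "?f T \<le> J" using close u by (intro infdist_le2[of "\<alpha> u"]) auto
  have J: "0 \<le> J" using close zero_le_dist order_trans by blast
  have "\<exists>t. 0 \<le> t \<and> t \<le> T \<and> ?f t \<le> K \<and> T - t \<le> 3 * L * (A + K + J)"
  proof (cases "?f T \<le> K")
    case True
    then show ?thesis using T L A K J by (intro exI[of _ T]) auto
  next
    case False
    have c: "continuous_on {0..T} ?f"
      by (intro continuous_intros continuous_on_subset[OF cont]) auto
    have "?f 0 = 0" using start by simp
    then obtain t where t: "t \<in> {0..T}" "?f t = K" "\<And>s. s \<in> {t..T} \<Longrightarrow> K \<le> ?f s"
      using IVT_last_exit[OF T c, of K] False K by (metis less_eq_real_def linorder_not_le)
    have sub: "{t..T} \<subseteq> {0..}" and "t \<le> T" using t(1) by auto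
    then have "T - t \<le> 3 * L * (A + ?f t + ?f T)"
      using quasi_geodesic_excursion_bound[OF con ne L A _ continuous_on_subset[OF cont sub]
          quasi_geodesic_on_subset[OF qg sub] K t(3)] by blast
    also have "\<dots> \<le> 3 * L * (A + K + J)" using t fT L by (intro mult_left_mono) auto
    finally show ?thesis using t by auto
  qed
  then obtain t where t: "0 \<le> t" "t \<le> T" "?f t \<le> K" "T - t \<le> 3 * L * (A + K + J)" by blast
  obtain z where "z \<in> closest_proj ?Z (\<beta> t)" using closest_proj_nonempty[OF cl ne] .
  then obtain v where v: "0 \<le> v" "dist (\<beta> t) (\<alpha> v) \<le> K" using t(3) by (auto simp: closest_proj_def)
  have "dist (\<beta> t) (\<beta> T) \<le> L * (T - t) + A" using quasi_geodesic_onD(2)[OF qg, of t T] t T by auto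
  also have "L * (T - t) \<le> L * (3 * L * (A + K + J))" using t(4) L by (intro mult_left_mono) auto
  finally have "dist (\<beta> t) (\<beta> T) \<le> 3 * L\<^sup>2 * (A + K + J) + A" by (simp add: power2_eq_square)
  moreover have "dist (\<alpha> u) (\<alpha> v) \<le> dist (\<beta> T) (\<alpha> u) + dist (\<beta> t) (\<beta> T) + dist (\<beta> t) (\<alpha> v)"
    using dist_triangle[of "\<alpha> u" "\<alpha> v" "\<beta> T"] dist_triangle[of "\<beta> T" "\<alpha> v" "\<beta> t"]
    by (simp add: dist_commute)
  moreover have "dist (\<alpha> u) (\<alpha> v) = \<bar>u - v\<bar>" using geo u v by (auto simp: geodesic_on_def)
  ultimately have "r \<le> v" using close v R by linarith
  then show thesis using that t v by blast
qed

section \<open>The constant kappa\<close>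

lemma kappa_ge: "3 * A \<le> kappa \<rho> L A" "3 * L\<^sup>2 \<le> kappa \<rho> L A"
  "1 + Inf {R. R > 0 \<and> (\<forall>r\<ge>R. 3 * L\<^sup>2 * \<rho> r \<le> r)} \<le> kappa \<rho> L A"
  by (auto simp: kappa_def)

lemma kappa_pos:
  assumes "1 \<le> L"
  shows "0 < kappa \<rho> L A"
proof -
  have "1 \<le> L\<^sup>2" using assms by (rule one_le_power)
  then show ?thesis using kappa_ge(2)[of L \<rho> A] by linarith
qed

text \<open>This makes the \<open>Inf\<close> in \<open>kappa\<close> a genuine infimum:
  \<open>\<rho> r / r\<close> is eventually below \<open>1 / (3 * L\<^sup>2)\<close>.\<close>

lemma sublinear_threshold:
  assumes "sublinear \<rho>" "1 \<le> L"
  shows "{R. R > 0 \<and> (\<forall>r\<ge>R. 3 * L\<^sup>2 * \<rho> r \<le> r)} \<noteq> {}"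
proof -
  have L2: "0 < 3 * L\<^sup>2" using assms(2) by simp
  then have "eventually (\<lambda>r. \<rho> r / r < 1 / (3 * L\<^sup>2)) at_top"
    using assms(1) unfolding sublinear_def by (intro order_tendstoD(2)[of _ 0]) auto
  then obtain R where R: "\<And>r. R \<le> r \<Longrightarrow> \<rho> r / r < 1 / (3 * L\<^sup>2)"
    unfolding eventually_at_top_linorder by blast
  have "3 * L\<^sup>2 * \<rho> r \<le> r" if "max R 1 \<le> r" for r
  proof -
    have "\<rho> r < 1 / (3 * L\<^sup>2) * r" using R[of r] that by (simp add: pos_divide_less_eq)
    then show ?thesis using L2 by (simp add: field_simps)
  qed
  then have "max R 1 \<in> {R. R > 0 \<and> (\<forall>r\<ge>R. 3 * L\<^sup>2 * \<rho> r \<le> r)}" by simp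
  then show ?thesis by blast
qed

text \<open>The infimum need not itself be an admissible threshold; the summand \<open>1\<close> in
  \<open>kappa\<close> puts \<open>r\<close> strictly above it and so above some admissible
  \<open>R\<close>.\<close>

lemma kappa_threshold:
  assumes "sublinear \<rho>" "1 \<le> L" "kappa \<rho> L A \<le> r"
  shows "3 * L\<^sup>2 * \<rho> r \<le> r"
proof -
  let ?S = "{R. R > 0 \<and> (\<forall>r\<ge>R. 3 * L\<^sup>2 * \<rho> r \<le> r)}"
  have "Inf ?S < r" using kappa_ge(3)[of L \<rho> A] assms(3) by linarith
  then obtain R where "R \<in> ?S" "R < r" using cInf_lessD[OF sublinear_threshold[OF assms(1,2)]] by blast
  then show ?thesis by simp
qed

text \<open>For nonnegative \<rho> a larger \<open>L\<close> leaves fewer admissible thresholds, so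
  their infimum grows. Hence the constants \<open>r\<close>, \<open>r\<close> can stand for all
  constants up to \<open>r\<close>.\<close>

lemma kappa_mono:
  assumes sub: "sublinear \<rho>" and nn: "\<And>r. 0 \<le> r \<Longrightarrow> 0 \<le> \<rho> r"
    and L: "1 \<le> L" "L \<le> L'" and A: "A \<le> A'"
  shows "kappa \<rho> L A \<le> kappa \<rho> L' A'"
proof -
  let ?S = "\<lambda>L. {R. R > 0 \<and> (\<forall>r\<ge>R. 3 * L\<^sup>2 * \<rho> r \<le> r)}"
  have LL: "L\<^sup>2 \<le> L'\<^sup>2" using L by (intro power_mono) auto
  have "?S L' \<subseteq> ?S L"
  proof
    fix R assume R: "R \<in> ?S L'"
    have "3 * L\<^sup>2 * \<rho> r \<le> r" if r: "R \<le> r" for r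
    proof -
      have "0 \<le> r" "3 * L'\<^sup>2 * \<rho> r \<le> r" using R r by auto
      moreover have "3 * L\<^sup>2 * \<rho> r \<le> 3 * L'\<^sup>2 * \<rho> r" using LL nn[OF \<open>0 \<le> r\<close>] by (intro mult_right_mono) auto
      ultimately show ?thesis by linarith
    qed
    then show "R \<in> ?S L" using R by simp
  qed
  moreover have "bdd_below (?S L)" by (intro bdd_belowI[of _ 0]) auto
  moreover have "?S L' \<noteq> {}" using sublinear_threshold[OF sub, of L'] L by simp
  ultimately have "Inf (?S L) \<le> Inf (?S L')" by (intro cInf_superset_mono)
  then have "1 + Inf (?S L) \<le> kappa \<rho> L' A'" using kappa_ge(3)[of L' \<rho> A'] by linarith
  moreover have "3 * A \<le> kappa \<rho> L' A'" using kappa_ge(1)[of A' \<rho> L'] A by linarith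
  moreover have "3 * L\<^sup>2 \<le> kappa \<rho> L' A'" using kappa_ge(2)[of L' \<rho> A'] LL by linarith
  ultimately show ?thesis by (simp add: kappa_def[of \<rho> L A])
qed

section \<open>Invariance of contraction under finite Hausdorff distance\<close>

lemma metric_diameter_le:
  assumes "\<And>p q. p \<in> S \<Longrightarrow> q \<in> S \<Longrightarrow> dist p q \<le> d" "0 \<le> d"
  shows "diameter S \<le> d"
  using assms by (auto simp: diameter_def intro!: cSUP_least)

lemma contracting_with_nonneg:
  assumes con: "contracting_with \<rho> Z" and ne: "Z \<noteq> {}" and mono: "mono_on {0..} \<rho>" and r: "0 \<le> r"
  shows "0 \<le> \<rho> r"
proof -
  obtain z where z: "z \<in> Z" using ne by blast
  then have "z \<in> closest_proj Z z" by (simp add: closest_proj_def)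
  then have "0 \<le> \<rho> (infdist z Z)" using contracting_with_dist_le[OF con, of z z z z] by (simp add: infdist_nonneg)
  also have "\<dots> \<le> \<rho> r" using z r by (intro mono_onD[OF mono]) auto
  finally show ?thesis .
qed

lemma geodesic_space_point:
  assumes "geodesic_space (UNIV :: 'a::metric_space set)" "0 \<le> s" "s \<le> dist x (y::'a)"
  obtains z where "dist x z = s" "dist z y = dist x y - s"
proof -
  obtain l \<gamma> where l: "0 \<le> l" "geodesic_on {0..l} \<gamma>" "\<gamma> 0 = x" "\<gamma> l = y"
    using assms(1) unfolding geodesic_space_def by blast
  have d: "dist (\<gamma> a) (\<gamma> b) = \<bar>a - b\<bar>" if "a \<in> {0..l}" "b \<in> {0..l}" for a b
    using l(2) that by (simp add: geodesic_on_def)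
  have "dist x y = l" using d[of 0 l] l by simp
  then show thesis using that[of "\<gamma> s"] d[of 0 s] d[of s l] l assms(2,3) by simp
qed

text \<open>The point \<open>p\<close> is \<open>C\<close>-close to some \<open>z\<close> in
  \<open>Z\<close> that is within \<open>2 * C\<close> of being nearest to \<open>x\<close>. The
  point \<open>x'\<close> at distance \<open>infdist x Z\<close> on a geodesic to \<open>z\<close>
  is within \<open>2 * C\<close> of \<open>z\<close>, hence of its own projection, and contraction
  compares the projections of \<open>x\<close> and \<open>x'\<close>.\<close>

lemma finite_hausdorff_projection_close:
  fixes Z Z' :: "'a::heine_borel set"
  assumes geo: "geodesic_space (UNIV :: 'a set)"
    and con: "contracting_with \<rho> Z" and ne: "Z \<noteq> {}"
    and C: "\<bar>infdist x Z - infdist x Z'\<bar> \<le> C" "\<And>y. y \<in> Z' \<Longrightarrow> \<exists>x\<in>Z. dist x y \<le> C"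
    and p: "p \<in> closest_proj Z' x" and q: "q \<in> closest_proj Z x"
  shows "dist p q \<le> 5 * C + \<rho> (infdist x Z)"
proof -
  have cl: "closed Z" using con by (simp add: contracting_with_def)
  obtain z where z: "z \<in> Z" "dist z p \<le> C" using C(2)[of p] closest_projD(1)[OF p] by blast
  have "dist x z \<le> dist x p + dist z p" by (metis dist_triangle dist_commute)
  then have xz: "dist x z \<le> infdist x Z + 2 * C" using z closest_projD(2)[OF p] C(1) by linarith
  have "infdist x Z \<le> dist x z" using z by (intro infdist_le)
  then obtain x' where x': "dist x x' = infdist x Z" "dist x' z = dist x z - infdist x Z"
    using geodesic_space_point[OF geo infdist_nonneg] by blast
  obtain q' where q': "q' \<in> closest_proj Z x'" using closest_proj_nonempty[OF cl ne] .
  have "dist q q' \<le> \<rho> (infdist x Z)"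
    using contracting_with_dist_le[OF con, of x x' q q'] x' q q' by simp
  moreover have "dist x' q' \<le> dist x' z" using closest_projD(2)[OF q'] infdist_le[OF z(1)] by simp
  moreover have "dist p q \<le> dist z p + dist x' z + dist x' q' + dist q q'"
    using dist_triangle[of p q z] dist_triangle[of z q x'] dist_triangle[of x' q q']
    by (simp add: dist_commute)
  ultimately show ?thesis using z xz x' by linarith
qed

text \<open>Distances to \<open>Z\<close> and to \<open>Z'\<close> differ by at most
  \<open>C\<close>, and projections to the two sets are close. The points \<open>x\<close> and
  \<open>y\<close> may be \<open>C\<close> farther apart than contraction of \<open>Z\<close>
  allows; an intermediate point \<open>y'\<close> on a geodesic bridges the excess.\<close>

lemma contracting_with_finite_hausdorff:
  fixes Z Z' :: "'a::heine_borel set"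
  assumes geo: "geodesic_space (UNIV :: 'a set)"
    and con: "contracting_with \<rho> Z" and ne: "Z \<noteq> {}" and mono: "mono_on {0..} \<rho>"
    and cl': "closed Z'"
    and C: "\<And>x. x \<in> Z \<Longrightarrow> \<exists>y\<in>Z'. dist x y \<le> C" "\<And>y. y \<in> Z' \<Longrightarrow> \<exists>x\<in>Z. dist x y \<le> C"
  shows "contracting_with (\<lambda>r. 14 * C + 4 * \<rho> (2 * r + 3 * C)) Z'"
  unfolding contracting_with_def
proof (intro conjI allI impI cl')
  fix x y assume xy: "dist x y \<le> infdist x Z'"
  have cl: "closed Z" using con by (simp add: contracting_with_def)
  obtain z0 where "z0 \<in> Z" using ne by blast
  then have ne': "Z' \<noteq> {}" and C0: "0 \<le> C" using C(1) by (blast, metis zero_le_dist order_trans)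
  have close: "\<bar>infdist w Z - infdist w Z'\<bar> \<le> C" for w
  proof -
    obtain z where z: "z \<in> closest_proj Z w" using closest_proj_nonempty[OF cl ne] .
    then obtain z1 where z1: "z1 \<in> Z'" "dist z z1 \<le> C" using C(1) closest_projD(1) by blast
    obtain z' where z': "z' \<in> closest_proj Z' w" using closest_proj_nonempty[OF cl' ne'] .
    then obtain z2 where z2: "z2 \<in> Z" "dist z2 z' \<le> C" using C(2) closest_projD(1) by blast
    have "infdist w Z' \<le> dist w z1" "infdist w Z \<le> dist w z2" using z1 z2 infdist_le by auto
    then show ?thesis
      using closest_projD(2)[OF z] closest_projD(2)[OF z'] z1 z2
        dist_triangle[of w z1 z] dist_triangle[of w z2 z'] dist_commute[of z2 z'] by linarith
  qed
  define e where "e = infdist x Z"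
  have e0: "0 \<le> e" by (simp add: e_def infdist_nonneg)
  have xy': "dist x y \<le> e + C" using xy close[of x] unfolding e_def by linarith
  \<comment> \<open>The distances to \<open>Z\<close> from \<open>x\<close>, \<open>y\<close> and
    the later \<open>y'\<close> are all at most \<open>2 * e + C\<close>, so \<open>m\<close>
    dominates every value of \<rho> that occurs.\<close>
  define m where "m = \<rho> (2 * e + C)"
  have le_m: "\<rho> s \<le> m" if "0 \<le> s" "s \<le> 2 * e + C" for s
    unfolding m_def using that by (intro mono_onD[OF mono]) auto
  have m0: "0 \<le> m" unfolding m_def by (rule contracting_with_nonneg[OF con ne mono]) (use e0 C0 in simp)
  have yZ: "infdist y Z \<le> 2 * e + C"
    using infdist_triangle[of y Z x] xy' unfolding e_def by (simp add: dist_commute)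
  obtain qx where qx: "qx \<in> closest_proj Z x" using closest_proj_nonempty[OF cl ne] .
  obtain qy where qy: "qy \<in> closest_proj Z y" using closest_proj_nonempty[OF cl ne] .
  have px: "dist p qx \<le> 5 * C + m" if "p \<in> closest_proj Z' x" for p
    using finite_hausdorff_projection_close[OF geo con ne close C(2) that qx] le_m[of e] e0 C0
    unfolding e_def[symmetric] by simp
  have py: "dist p qy \<le> 5 * C + m" if "p \<in> closest_proj Z' y" for p
    using finite_hausdorff_projection_close[OF geo con ne close C(2) that qy]
      le_m[of "infdist y Z"] yZ infdist_nonneg[of y Z] by simp
  have "dist qx qy \<le> 4 * C + 2 * m"
  proof (cases "dist x y \<le> e")
    case True
    then have "dist qx qy \<le> m"
      using contracting_with_dist_le[OF con, of x y qx qy] qx qy le_m[of e] e0 C0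
      unfolding e_def[symmetric] by simp
    then show ?thesis using m0 C0 by simp
  next
    case False
    then obtain y' where y': "dist x y' = e" "dist y' y = dist x y - e"
      using geodesic_space_point[OF geo e0, of x y] by (metis linear)
    obtain q' where q': "q' \<in> closest_proj Z y'" using closest_proj_nonempty[OF cl ne] .
    have 1: "dist qx q' \<le> m"
      using contracting_with_dist_le[OF con, of x y' qx q'] qx q' y' le_m[of e] e0 C0
      unfolding e_def[symmetric] by simp
    \<comment> \<open>\<open>y'\<close> and \<open>y\<close> are at most \<open>C\<close> apart:
      either contraction applies to them, or both are within \<open>2 * C\<close> of
      \<open>Z\<close> and so near their projections.\<close>
    have 2: "dist q' qy \<le> 4 * C + m"
    proof (cases "C \<le> infdist y' Z")
      case True
      have "infdist y' Z \<le> 2 * e"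
        using infdist_triangle[of y' Z x] y' unfolding e_def by (simp add: dist_commute)
      then have "dist q' qy \<le> m"
        using contracting_with_dist_le[OF con, of y' y q' qy] q' qy y' xy' True
          le_m[of "infdist y' Z"] C0 infdist_nonneg[of y' Z] by simp
      then show ?thesis using C0 by simp
    next
      case False
      have "infdist y Z \<le> infdist y' Z + dist y y'" by (rule infdist_triangle)
      then have "dist q' qy \<le> 4 * C"
        using False y' xy' closest_projD(2)[OF q'] closest_projD(2)[OF qy]
          dist_triangle[of q' qy y'] dist_triangle[of y' qy y] by (simp add: dist_commute)
      then show ?thesis using m0 by simp
    qed
    show ?thesis using 1 2 dist_triangle[of qx qy q'] by simp
  qed
  then have q: "dist qx qy \<le> 4 * C + 2 * m" .
  \<comment> \<open>The worst case is a projection of \<open>x\<close> against one of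
    \<open>y\<close>: \<open>(5 * C + m) + (4 * C + 2 * m) + (5 * C + m)\<close>.\<close>
  have "dist p p' \<le> 14 * C + 4 * m"
    if "p \<in> closest_proj Z' x \<union> closest_proj Z' y" "p' \<in> closest_proj Z' x \<union> closest_proj Z' y" for p p'
  proof -
    have xx: "dist a b \<le> 10 * C + 2 * m" if "a \<in> closest_proj Z' x" "b \<in> closest_proj Z' x" for a b
      using px[OF that(1)] px[OF that(2)] dist_triangle2[of a b qx] by linarith
    have yy: "dist a b \<le> 10 * C + 2 * m" if "a \<in> closest_proj Z' y" "b \<in> closest_proj Z' y" for a b
      using py[OF that(1)] py[OF that(2)] dist_triangle2[of a b qy] by linarith
    have xyy: "dist a b \<le> 14 * C + 4 * m" if "a \<in> closest_proj Z' x" "b \<in> closest_proj Z' y" for a b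
      using px[OF that(1)] py[OF that(2)] dist_triangle[of a b qx] dist_triangle2[of qx b qy] q by linarith
    show ?thesis using that xx[of p p'] yy[of p p'] xyy[of p p'] xyy[of p' p] C0 m0
      by (fastforce simp: dist_commute)
  qed
  then have "diameter (closest_proj Z' x \<union> closest_proj Z' y) \<le> 14 * C + 4 * m"
    using C0 m0 by (intro metric_diameter_le) auto
  also have "m \<le> \<rho> (2 * infdist x Z' + 3 * C)"
    unfolding m_def using close[of x] e0 C0 unfolding e_def
    by (intro mono_onD[OF mono]) (auto simp: infdist_nonneg)
  finally show "diameter (closest_proj Z' x \<union> closest_proj Z' y) \<le> 14 * C + 4 * \<rho> (2 * infdist x Z' + 3 * C)"
    by simp
qed

lemma sublinear_rescale:
  assumes "sublinear \<rho>" "0 \<le> C"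
  shows "sublinear (\<lambda>r. 14 * C + 4 * \<rho> (2 * r + 3 * C))"
proof -
  have mono: "mono_on {0..} \<rho>" and ev: "eventually (\<lambda>r. 0 \<le> \<rho> r) at_top"
    and lim: "((\<lambda>r. \<rho> r / r) \<longlongrightarrow> 0) at_top"
    using assms(1) by (auto simp: sublinear_def)
  have "filterlim (\<lambda>r. 3 * C + 2 * r) at_top at_top"
    by (intro filterlim_tendsto_add_at_top[OF tendsto_const]
        filterlim_tendsto_pos_mult_at_top[OF tendsto_const _ filterlim_ident]) simp
  then have top: "filterlim (\<lambda>r. 2 * r + 3 * C) at_top at_top" by (simp add: add.commute)
  have inv: "((\<lambda>r. c / r) \<longlongrightarrow> 0) at_top" for c :: real
    by (intro tendsto_divide_0[OF tendsto_const] filterlim_at_top_imp_at_infinity filterlim_ident)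
  have "mono_on {0..} (\<lambda>r. 14 * C + 4 * \<rho> (2 * r + 3 * C))"
    using assms(2) by (intro mono_onI) (auto intro!: mono_onD[OF mono])
  moreover have "eventually (\<lambda>r. 0 \<le> 14 * C + 4 * \<rho> (2 * r + 3 * C)) at_top"
    using eventually_compose_filterlim[OF ev top] by eventually_elim (use assms(2) in simp)
  moreover have "((\<lambda>r. (14 * C + 4 * \<rho> (2 * r + 3 * C)) / r) \<longlongrightarrow> 0) at_top"
  proof -
    \<comment> \<open>With \<open>s = 2 * r + 3 * C\<close> the quotient is
      \<open>14 * C / r + 4 * (\<rho> s / s) * (s / r)\<close>, where \<open>s / r\<close> tends to
      \<open>2\<close>.\<close>
    have "((\<lambda>r. 14 * C / r + 4 * (\<rho> (2 * r + 3 * C) / (2 * r + 3 * C)) * (2 + 3 * C / r))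
        \<longlongrightarrow> 0 + 4 * 0 * (2 + 0)) at_top"
      by (intro tendsto_intros filterlim_compose[OF lim top] inv)
    then have "((\<lambda>r. 14 * C / r + 4 * (\<rho> (2 * r + 3 * C) / (2 * r + 3 * C)) * (2 + 3 * C / r))
        \<longlongrightarrow> 0) at_top" by simp
    then show ?thesis
    proof (rule Lim_transform_eventually)
      show "eventually (\<lambda>r. 14 * C / r + 4 * (\<rho> (2 * r + 3 * C) / (2 * r + 3 * C)) * (2 + 3 * C / r)
          = (14 * C + 4 * \<rho> (2 * r + 3 * C)) / r) at_top"
        using eventually_gt_at_top[of 0]
      proof eventually_elim
        case (elim r)
        have "2 * r + 3 * C \<noteq> 0" using assms(2) elim by simp
        then have "4 * (\<rho> (2 * r + 3 * C) / (2 * r + 3 * C)) * ((2 * r + 3 * C) / r) = 4 * \<rho> (2 * r + 3 * C) / r"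
          by simp
        moreover have "2 + 3 * C / r = (2 * r + 3 * C) / r" using elim by (simp add: add_divide_distrib)
        ultimately show ?case by (simp only: add_divide_distrib[of "14 * C"])
      qed
    qed
  qed
  ultimately show ?thesis by (simp add: sublinear_def)
qed

section \<open>Boundary classes\<close>

lemma geodesic_on_imp_quasi_geodesic_on:
  assumes "geodesic_on I \<gamma>" "1 \<le> L" "0 \<le> A"
  shows "quasi_geodesic_on L A I \<gamma>"
  unfolding quasi_geodesic_on_def
proof (intro ballI)
  fix s t assume st: "s \<in> I" "t \<in> I"
  have "1 / L * \<bar>s - t\<bar> \<le> 1 * \<bar>s - t\<bar>" "1 * \<bar>s - t\<bar> \<le> L * \<bar>s - t\<bar>"
    using assms(2) by (intro mult_right_mono; simp)+
  then show "1 / L * \<bar>s - t\<bar> - A \<le> dist (\<gamma> s) (\<gamma> t) \<and> dist (\<gamma> s) (\<gamma> t) \<le> L * \<bar>s - t\<bar> + A"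
    using assms(1,3) st by (simp add: geodesic_on_def)
qed

lemma geodesic_on_continuous:
  assumes "geodesic_on I \<gamma>"
  shows "continuous_on I \<gamma>"
  using assms by (force simp: continuous_on_iff geodesic_on_def dist_real_def)

lemma geodesic_ray_dist_origin:
  assumes "geodesic_on {0..} \<alpha>" "0 \<le> v"
  shows "dist (\<alpha> 0) (\<alpha> v) = v" "dist (\<alpha> v) (\<alpha> 0) = v"
  using assms by (auto simp: geodesic_on_def)

lemma finite_hausdorff_dist_sym: "finite_hausdorff_dist S T \<Longrightarrow> finite_hausdorff_dist T S"
  unfolding finite_hausdorff_dist_def by (metis dist_commute)

lemma finite_hausdorff_dist_trans:
  assumes "finite_hausdorff_dist S T" "finite_hausdorff_dist T U"
  shows "finite_hausdorff_dist S U"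
proof -
  obtain C where C: "\<forall>x\<in>S. \<exists>y\<in>T. dist x y \<le> C" "\<forall>y\<in>T. \<exists>x\<in>S. dist x y \<le> C"
    using assms(1) unfolding finite_hausdorff_dist_def by blast
  obtain D where D: "\<forall>x\<in>T. \<exists>y\<in>U. dist x y \<le> D" "\<forall>y\<in>U. \<exists>x\<in>T. dist x y \<le> D"
    using assms(2) unfolding finite_hausdorff_dist_def by blast
  have tri: "dist x z \<le> C + D" if "dist x y \<le> C" "dist y z \<le> D" for x y z :: 'a
    using dist_triangle[of x z y] that by linarith
  have "\<exists>z\<in>U. dist x z \<le> C + D" if "x \<in> S" for x using C(1) D(1) tri that by meson
  moreover have "\<exists>x\<in>S. dist x z \<le> C + D" if "z \<in> U" for z using C(2) D(2) tri that by meson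
  ultimately show ?thesis unfolding finite_hausdorff_dist_def by blast
qed

lemma equiv_ray_rel: "equiv (contracting_rays bp) (ray_rel bp)"
proof (rule equivI)
  have "finite_hausdorff_dist S S" for S :: "'a set"
    unfolding finite_hausdorff_dist_def by (intro exI[of _ 0]) auto
  then show "refl_on (contracting_rays bp) (ray_rel bp)" by (auto simp: refl_on_def ray_rel_def)
  show "ray_rel bp \<subseteq> contracting_rays bp \<times> contracting_rays bp" by (auto simp: ray_rel_def)
  show "sym (ray_rel bp)" by (auto simp: sym_def ray_rel_def intro: finite_hausdorff_dist_sym)
  show "trans (ray_rel bp)" by (auto simp: trans_def ray_rel_def intro: finite_hausdorff_dist_trans)
qed

lemma boundary_class_ray:
  assumes "\<zeta> \<in> contracting_boundary bp" "\<gamma> \<in> \<zeta>"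
  shows "\<gamma> \<in> contracting_rays bp"
  using assms by (auto simp: contracting_boundary_def quotient_def ray_rel_def)

lemma boundary_class_hausdorff:
  assumes "\<zeta> \<in> contracting_boundary bp" "\<gamma> \<in> \<zeta>" "\<gamma>' \<in> \<zeta>"
  shows "finite_hausdorff_dist (\<gamma> ` {0..}) (\<gamma>' ` {0..})"
  using quotient_eqI quotient_eq_iff[OF equiv_ray_rel, of \<zeta> bp \<zeta> \<gamma> \<gamma>'] assms
  by (simp add: contracting_boundary_def ray_rel_def)

lemma boundary_class_memI:
  assumes "\<zeta> \<in> contracting_boundary bp" "\<gamma> \<in> \<zeta>" "\<gamma>' \<in> contracting_rays bp"
    and "finite_hausdorff_dist (\<gamma> ` {0..}) (\<gamma>' ` {0..})"
  shows "\<gamma>' \<in> \<zeta>"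
proof -
  have "(\<gamma>, \<gamma>') \<in> ray_rel bp" using boundary_class_ray[OF assms(1,2)] assms(3,4) by (simp add: ray_rel_def)
  then show ?thesis
    using in_quotient_imp_closed[OF equiv_ray_rel, of \<zeta> bp \<gamma> \<gamma>'] assms(1,2)
    by (simp add: contracting_boundary_def)
qed

lemma boundary_class_origin:
  assumes "\<zeta> \<in> contracting_boundary bp" "\<gamma> \<in> \<zeta>"
  shows "\<gamma> 0 = bp"
  using boundary_class_ray[OF assms] by (simp add: contracting_rays_def)

text \<open>The Hausdorff bound \<open>H\<close> depends on \<open>\<alpha>'\<close>, so it serves
  only to bound excursions: \<open>\<alpha>'\<close> returns within \<open>K\<close> of \<alpha> at
  arbitrarily late times. In between it stays within \<open>7 * K\<close>, a bound independent of
  \<open>\<alpha>'\<close>.\<close>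

lemma geodesic_rays_uniformly_close:
  fixes bp :: "'a::heine_borel"
  assumes z: "\<zeta> \<in> contracting_boundary bp" and a: "\<alpha> \<in> \<zeta>" "geodesic_on {0..} \<alpha>"
  obtains C where "\<And>\<alpha>' t. \<alpha>' \<in> \<zeta> \<Longrightarrow> geodesic_on {0..} \<alpha>' \<Longrightarrow> 0 \<le> t \<Longrightarrow> dist (\<alpha> t) (\<alpha>' t) \<le> C"
proof -
  let ?Z = "\<alpha> ` {0..}"
  obtain \<rho> where sub: "sublinear \<rho>" and con: "contracting_with \<rho> ?Z"
    using boundary_class_ray[OF z a(1)] by (auto simp: contracting_rays_def contracting_def)
  have ne: "?Z \<noteq> {}" and cl: "closed ?Z" using con by (auto simp: contracting_with_def)
  define K where "K = kappa \<rho> 1 0"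
  have K: "0 < K" "3 * 0 \<le> K" "\<And>r. K \<le> r \<Longrightarrow> 3 * 1\<^sup>2 * \<rho> r \<le> r"
    using kappa_pos[of 1 \<rho> 0] kappa_threshold[OF sub, of 1 0] by (auto simp: K_def)
  have "dist (\<alpha> t) (\<alpha>' t) \<le> 14 * K" if b: "\<alpha>' \<in> \<zeta>" "geodesic_on {0..} \<alpha>'" and t: "0 \<le> t" for \<alpha>' t
  proof -
    have qg: "quasi_geodesic_on 1 0 {0..} \<alpha>'" using geodesic_on_imp_quasi_geodesic_on[OF b(2)] by simp
    have cont: "continuous_on {0..} \<alpha>'" by (rule geodesic_on_continuous[OF b(2)])
    obtain H where H: "\<And>y. y \<in> \<alpha>' ` {0..} \<Longrightarrow> \<exists>x\<in>?Z. dist x y \<le> H"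
      using boundary_class_hausdorff[OF z a(1) b(1)] unfolding finite_hausdorff_dist_def by blast
    have fin: "infdist (\<alpha>' s) ?Z \<le> H" if "0 \<le> s" for s
      using H[of "\<alpha>' s"] that by (auto intro: infdist_le2 simp: dist_commute)
    have orig: "\<alpha> 0 = bp" "\<alpha>' 0 = bp" using boundary_class_origin[OF z] a b by auto
    have "\<exists>T\<ge>t. infdist (\<alpha>' T) ?Z \<le> K"
    proof (rule ccontr)
      assume "\<not> ?thesis"
      then have far: "K \<le> infdist (\<alpha>' s) ?Z" if "t \<le> s" for s using that by force
      \<comment> \<open>With end distances at most \<open>H\<close> an excursion lasts at most
        \<open>6 * H\<close>, less than \<open>T - t\<close>.\<close>
      define T where "T = t + 6 * H + 1"
      have "0 \<le> H" using fin[OF t] infdist_nonneg order_trans by blast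
      then have T: "t \<le> T" by (simp add: T_def)
      have sub': "{t..T} \<subseteq> {0..}" using t by auto
      have "T - t \<le> 3 * 1 * (0 + infdist (\<alpha>' t) ?Z + infdist (\<alpha>' T) ?Z)"
        using far by (intro quasi_geodesic_excursion_bound[OF con ne _ _ T continuous_on_subset[OF cont sub']
            quasi_geodesic_on_subset[OF qg sub'] K]) auto
      also have "\<dots> \<le> 6 * H" using fin[OF t] fin[of T] T t by simp
      finally show False by (simp add: T_def)
    qed
    then obtain T where T: "t \<le> T" "infdist (\<alpha>' T) ?Z \<le> K" by blast
    have sub': "{0..T} \<subseteq> {0..}" by auto
    have "infdist (\<alpha>' 0) ?Z = 0" using orig by (metis atLeast_iff image_eqI infdist_zero order_refl)
    then have "infdist (\<alpha>' t) ?Z \<le> K + 0 + 3 * 1\<^sup>2 * (0 + 2 * K)"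
      using t T K(1) by (intro quasi_geodesic_near_contracting[OF con ne _ _ continuous_on_subset[OF cont sub']
            quasi_geodesic_on_subset[OF qg sub'] K]) auto
    then have le: "infdist (\<alpha>' t) ?Z \<le> 7 * K" by simp
    obtain q where "q \<in> closest_proj ?Z (\<alpha>' t)" using closest_proj_nonempty[OF cl ne] .
    then obtain u where u: "0 \<le> u" "dist (\<alpha>' t) (\<alpha> u) \<le> 7 * K" using le by (auto simp: closest_proj_def)
    \<comment> \<open>Both parameters are distances from the basepoint.\<close>
    have "\<bar>u - t\<bar> \<le> 7 * K"
      using geodesic_ray_dist_origin[OF a(2) u(1)] geodesic_ray_dist_origin[OF b(2) t] orig u(2)
        dist_triangle[of bp "\<alpha> u" "\<alpha>' t"] dist_triangle[of bp "\<alpha>' t" "\<alpha> u"]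
      by (simp add: dist_commute)
    moreover have "dist (\<alpha> u) (\<alpha> t) = \<bar>u - t\<bar>" using a(2) u t by (simp add: geodesic_on_def)
    ultimately show ?thesis
      using u(2) dist_triangle[of "\<alpha> t" "\<alpha>' t" "\<alpha> u"] by (simp add: dist_commute)
  qed
  then show thesis using that by blast
qed

section \<open>The function \<open>rho_class\<close>\<close>

lemma rho_class_bdd_above:
  "bdd_above {diameter (closest_proj (\<alpha> ` {0..}) x \<union> closest_proj (\<alpha> ` {0..}) y) | \<alpha> x y.
    \<alpha> \<in> \<zeta> \<and> geodesic_on {0..} \<alpha> \<and>
    dist x y \<le> infdist x (\<alpha> ` {0..}) \<and> infdist x (\<alpha> ` {0..}) \<le> r}"
proof (rule bdd_aboveI, clarify)
  fix \<alpha> :: "real \<Rightarrow> 'a" and x y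
  let ?Z = "\<alpha> ` {0..}"
  assume xy: "dist x y \<le> infdist x ?Z" "infdist x ?Z \<le> r"
  have r: "0 \<le> r" using xy(2) infdist_nonneg order_trans by blast
  have "infdist y ?Z \<le> infdist x ?Z + dist y x" by (rule infdist_triangle)
  then have yr: "infdist y ?Z \<le> 2 * r" using xy by (simp add: dist_commute)
  have dx: "dist x p \<le> 3 * r" if "p \<in> closest_proj ?Z x \<union> closest_proj ?Z y" for p
    using that
  proof
    assume "p \<in> closest_proj ?Z x"
    then show ?thesis using xy(2) r by (simp add: closest_proj_def)
  next
    assume "p \<in> closest_proj ?Z y"
    then show ?thesis using yr xy dist_triangle[of x p y] by (simp add: closest_proj_def)
  qed
  show "diameter (closest_proj ?Z x \<union> closest_proj ?Z y) \<le> 6 * r"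
  proof (rule metric_diameter_le)
    fix p q assume "p \<in> closest_proj ?Z x \<union> closest_proj ?Z y" "q \<in> closest_proj ?Z x \<union> closest_proj ?Z y"
    then show "dist p q \<le> 6 * r" using dx[of p] dx[of q] dist_triangle3[of p q x] by linarith
  qed (use r in simp)
qed

lemma contracting_with_rho_class:
  assumes "\<zeta> \<in> contracting_boundary bp" "\<alpha> \<in> \<zeta>" "geodesic_on {0..} \<alpha>"
  shows "contracting_with (rho_class \<zeta>) (\<alpha> ` {0..})"
proof -
  have "closed (\<alpha> ` {0..})"
    using boundary_class_ray[OF assms(1,2)] by (auto simp: contracting_rays_def contracting_def contracting_with_def)
  moreover have "diameter (closest_proj (\<alpha> ` {0..}) x \<union> closest_proj (\<alpha> ` {0..}) y) \<le> rho_class \<zeta> (infdist x (\<alpha> ` {0..}))"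
    if "dist x y \<le> infdist x (\<alpha> ` {0..})" for x y
    unfolding rho_class_def by (rule cSup_upper[OF _ rho_class_bdd_above]) (use assms that in blast)
  ultimately show ?thesis by (simp add: contracting_with_def)
qed

text \<open>All geodesic rays in \<zeta> lie within one constant \<open>C\<close> of \<alpha>, so a
  single sublinear \<open>\<rho>'\<close> makes all of them contracting. The supremum
  \<open>rho_class \<zeta>\<close> is at most \<open>\<rho>'\<close> and inherits its
  growth.\<close>

lemma sublinear_rho_class:
  fixes bp :: "'a::heine_borel"
  assumes geo: "geodesic_space (UNIV :: 'a set)"
    and z: "\<zeta> \<in> contracting_boundary bp" and a: "\<alpha> \<in> \<zeta>" "geodesic_on {0..} \<alpha>"
  shows "sublinear (rho_class \<zeta>)" "\<And>r. 0 \<le> r \<Longrightarrow> 0 \<le> rho_class \<zeta> r"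
proof -
  define S where "S r = {diameter (closest_proj (\<alpha> ` {0..}) x \<union> closest_proj (\<alpha> ` {0..}) y) | \<alpha> x y.
    \<alpha> \<in> \<zeta> \<and> geodesic_on {0..} \<alpha> \<and>
    dist x y \<le> infdist x (\<alpha> ` {0..}) \<and> infdist x (\<alpha> ` {0..}) \<le> r}" for r
  have rc: "rho_class \<zeta> r = Sup (S r)" for r by (simp add: rho_class_def S_def)
  have bdd: "bdd_above (S r)" for r unfolding S_def by (rule rho_class_bdd_above)
  have ne: "S r \<noteq> {}" if "0 \<le> r" for r
  proof -
    have "diameter (closest_proj (\<alpha> ` {0..}) (\<alpha> 0) \<union> closest_proj (\<alpha> ` {0..}) (\<alpha> 0)) \<in> S r"
      unfolding S_def mem_Collect_eq
      by (intro exI[of _ \<alpha>] exI[of _ "\<alpha> 0"] conjI refl) (use a that in simp_all)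
    then show ?thesis by blast
  qed
  have mono: "mono_on {0..} (rho_class \<zeta>)"
  proof (rule mono_onI)
    fix r s :: real assume rs: "r \<in> {0..}" "s \<in> {0..}" "r \<le> s"
    have "S r \<subseteq> S s" unfolding S_def using rs(3) by fastforce
    then show "rho_class \<zeta> r \<le> rho_class \<zeta> s"
      unfolding rc using ne[of r] rs(1) bdd[of s] by (intro cSup_subset_mono) auto
  qed
  show nn: "0 \<le> rho_class \<zeta> r" if "0 \<le> r" for r
    using contracting_with_nonneg[OF contracting_with_rho_class[OF z a] _ mono that] by simp
  obtain C where C: "\<And>\<alpha>' t. \<alpha>' \<in> \<zeta> \<Longrightarrow> geodesic_on {0..} \<alpha>' \<Longrightarrow> 0 \<le> t \<Longrightarrow> dist (\<alpha> t) (\<alpha>' t) \<le> C"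
    using geodesic_rays_uniformly_close[OF z a] by blast
  have C0: "0 \<le> C" using C[OF a, of 0] by simp
  obtain \<rho> where sub: "sublinear \<rho>" and con: "contracting_with \<rho> (\<alpha> ` {0..})"
    using boundary_class_ray[OF z a(1)] by (auto simp: contracting_rays_def contracting_def)
  define \<rho>' where "\<rho>' r = 14 * C + 4 * \<rho> (2 * r + 3 * C)" for r
  have sub': "sublinear \<rho>'" unfolding \<rho>'_def by (rule sublinear_rescale[OF sub C0])
  have con': "contracting_with \<rho>' (\<alpha>' ` {0..})" if b: "\<alpha>' \<in> \<zeta>" "geodesic_on {0..} \<alpha>'" for \<alpha>'
    unfolding \<rho>'_def
  proof (rule contracting_with_finite_hausdorff[OF geo con])
    show "mono_on {0..} \<rho>" using sub by (simp add: sublinear_def)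
    show "closed (\<alpha>' ` {0..})" using contracting_with_rho_class[OF z b] by (simp add: contracting_with_def)
  qed (use C[OF b] in auto)
  have le: "rho_class \<zeta> r \<le> \<rho>' r" if r: "0 \<le> r" for r
    unfolding rc
  proof (rule cSup_least[OF ne[OF r]])
    fix d assume "d \<in> S r"
    then obtain \<alpha>' x y where d: "d = diameter (closest_proj (\<alpha>' ` {0..}) x \<union> closest_proj (\<alpha>' ` {0..}) y)"
      "\<alpha>' \<in> \<zeta>" "geodesic_on {0..} \<alpha>'" "dist x y \<le> infdist x (\<alpha>' ` {0..})" "infdist x (\<alpha>' ` {0..}) \<le> r"
      unfolding S_def by blast
    have "d \<le> \<rho>' (infdist x (\<alpha>' ` {0..}))"
      using con'[OF d(2,3)] d(4) unfolding d(1) contracting_with_def by blast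
    also have "\<dots> \<le> \<rho>' r"
      using sub' d(5) r by (auto simp: sublinear_def infdist_nonneg intro: mono_onD)
    finally show "d \<le> \<rho>' r" .
  qed
  have "((\<lambda>r. rho_class \<zeta> r / r) \<longlongrightarrow> 0) at_top"
  proof (rule tendsto_sandwich[where f = "\<lambda>_. 0"])
    show "((\<lambda>r. \<rho>' r / r) \<longlongrightarrow> 0) at_top" using sub' by (simp add: sublinear_def)
    show "eventually (\<lambda>r. rho_class \<zeta> r / r \<le> \<rho>' r / r) at_top"
      using eventually_ge_at_top[of 0] by eventually_elim (auto intro: divide_right_mono le)
    show "eventually (\<lambda>r. 0 \<le> rho_class \<zeta> r / r) at_top"
      using eventually_ge_at_top[of 0] by eventually_elim (auto intro: divide_nonneg_nonneg nn)
  qed simp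
  moreover have "eventually (\<lambda>r. 0 \<le> rho_class \<zeta> r) at_top"
    using eventually_ge_at_top[of 0] by eventually_elim (rule nn)
  ultimately show "sublinear (rho_class \<zeta>)" using mono by (simp add: sublinear_def)
qed

section \<open>Switching between rays\<close>

lemma quasi_geodesic_onI:
  assumes "\<And>s t. s \<in> I \<Longrightarrow> t \<in> I \<Longrightarrow> s \<le> t \<Longrightarrow>
    (t - s) / L - A \<le> dist (\<gamma> s) (\<gamma> t) \<and> dist (\<gamma> s) (\<gamma> t) \<le> L * (t - s) + A"
  shows "quasi_geodesic_on L A I \<gamma>"
  unfolding quasi_geodesic_on_def
proof (intro ballI)
  fix s t assume st: "s \<in> I" "t \<in> I"
  show "1 / L * \<bar>s - t\<bar> - A \<le> dist (\<gamma> s) (\<gamma> t) \<and> dist (\<gamma> s) (\<gamma> t) \<le> L * \<bar>s - t\<bar> + A"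
    using assms[OF st] assms[OF st(2,1)] by (cases "s \<le> t") (simp_all add: dist_commute)
qed

text \<open>
  The weights make the jump point optimal: moving back along \<open>\<beta>\<close> or forward along \<open>\<alpha>\<close> cannot
  bring the two rays closer than the jump plus a definite fraction of the parameter moved.
\<close>

lemma weighted_jump_point:
  fixes \<alpha> \<beta> :: "real \<Rightarrow> 'a::metric_space"
  assumes a: "geodesic_on {0..} \<alpha>" and start: "\<beta> 0 = \<alpha> 0"
    and L: "1 \<le> L" and A: "0 \<le> A"
    and cont: "continuous_on {0..} \<beta>" and qg: "quasi_geodesic_on L A {0..} \<beta>"
    and T: "0 \<le> T" and u1: "0 \<le> u1"
    and early: "dist (\<beta> T) (\<alpha> u1) + T / (4 * L) - u1 / 2 < - (L * M + A) / 2"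
  obtains t u where "0 \<le> t" "M < t" "0 \<le> u"
    "\<And>t' u'. 0 \<le> t' \<Longrightarrow> t' \<le> t \<Longrightarrow> u \<le> u' \<Longrightarrow>
      dist (\<beta> t) (\<alpha> u) + (t - t') / (4 * L) + (u' - u) / 2 \<le> dist (\<beta> t') (\<alpha> u')"
proof -
  define G where "G t u = dist (\<beta> t) (\<alpha> u) + t / (4 * L) - u / 2" for t u
  have far: "u \<le> dist (\<beta> t) (\<alpha> u) + L * t + A" if "0 \<le> t" "0 \<le> u" for t u
    using dist_triangle[of "\<alpha> 0" "\<alpha> u" "\<beta> t"] geodesic_ray_dist_origin(1)[OF a that(2)]
      quasi_geodesic_onD(2)[OF qg, of 0 t] that start by simp
  \<comment> \<open>Beyond \<open>U\<close> the value of \<open>G\<close> is at least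
    \<open>G T u1\<close>, so a minimum over the compact rectangle is one over all
    \<open>u' \<ge> 0\<close>.\<close>
  define U where "U = max u1 (2 * (G T u1 + L * T + A))"
  have U: "0 \<le> U" "u1 \<le> U" using u1 by (auto simp: U_def)
  have c: "continuous_on ({0..T} \<times> {0..U}) (\<lambda>p. G (fst p) (snd p))"
    unfolding G_def using L
    by (intro continuous_intros continuous_on_compose2[OF cont] continuous_on_compose2[OF geodesic_on_continuous[OF a]]) auto
  have "compact ({0..T} \<times> {0..U})" by (intro compact_Times compact_Icc)
  moreover have "{0..T} \<times> {0..U} \<noteq> {}" using T U by auto
  ultimately obtain p where p: "p \<in> {0..T} \<times> {0..U}" "\<And>q. q \<in> {0..T} \<times> {0..U} \<Longrightarrow> G (fst p) (snd p) \<le> G (fst q) (snd q)"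
    using continuous_attains_inf[OF _ _ c] by blast
  define t where "t = fst p"
  define u where "u = snd p"
  have tu: "0 \<le> t" "t \<le> T" "0 \<le> u" using p(1) by (auto simp: t_def u_def)
  have min1: "G t u \<le> G t' u'" if "0 \<le> t'" "t' \<le> T" "0 \<le> u'" "u' \<le> U" for t' u'
    using p(2)[of "(t', u')"] that by (simp add: t_def u_def)
  have min: "G t u \<le> G t' u'" if t': "0 \<le> t'" "t' \<le> T" "0 \<le> u'" for t' u'
  proof (cases "u' \<le> U")
    case False
    have "L * t' \<le> L * T" using t' L by (intro mult_left_mono) auto
    moreover have "0 \<le> t' / (4 * L)" using t' L by simp
    ultimately have "G T u1 \<le> G t' u'"
      using far[OF t'(1,3)] False unfolding G_def[of t'] U_def by (simp add: max_def split: if_splits)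
    then show ?thesis using min1[of T u1] T u1 U by simp
  qed (use min1 t' in blast)
  \<comment> \<open>Going to \<open>\<alpha> u\<close> through \<open>\<beta> t\<close> bounds
    \<open>u\<close> by \<open>dist (\<beta> t) (\<alpha> u) + L * t + A\<close>. So negative a
    minimum then forces \<open>t\<close> beyond \<open>M\<close>.\<close>
  have "G t u < - (L * M + A) / 2" using min[OF T order_refl u1] early unfolding G_def[of T] by simp
  moreover have "0 \<le> t / (4 * L)" using tu L by simp
  moreover have arith: "b < c" if "d + a - u / 2 < - (b + A) / 2" "0 \<le> a" "u \<le> d + c + A" "0 \<le> d"
    for a b c d u :: real using that by simp
  ultimately have "L * M < L * t"
    using arith[OF _ _ far[OF tu(1,3)] zero_le_dist] unfolding G_def by blast
  then have "M < t" using L by simp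
  moreover have "dist (\<beta> t) (\<alpha> u) + (t - t') / (4 * L) + (u' - u) / 2 \<le> dist (\<beta> t') (\<alpha> u')"
    if "0 \<le> t'" "t' \<le> t" "u \<le> u'" for t' u'
    using min[of t' u'] that tu unfolding G_def by (simp add: diff_divide_distrib)
  ultimately show thesis using that tu by blast
qed

text \<open>The ray \<gamma> follows \<beta> to the optimal jump point, crosses by a geodesic and
  continues along \<alpha>. Optimality yields the lower bounds between different pieces: time counts
  at rate \<open>1 / (4 * L)\<close> on \<beta>, \<open>1\<close> on the jump and
  \<open>1 / 2\<close> on \<alpha>, however long the jump is.\<close>

lemma quasi_geodesic_switch:
  fixes \<alpha> \<beta> :: "real \<Rightarrow> 'a::metric_space"
  assumes geo: "geodesic_space (UNIV :: 'a set)"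
    and a: "geodesic_on {0..} \<alpha>" and start: "\<beta> 0 = \<alpha> 0"
    and L: "1 \<le> L" and A: "0 \<le> A"
    and cont: "continuous_on {0..} \<beta>" and qg: "quasi_geodesic_on L A {0..} \<beta>"
    and T: "0 \<le> T" and u1: "0 \<le> u1"
    and early: "dist (\<beta> T) (\<alpha> u1) + T / (4 * L) - u1 / 2 < - (L * M + A) / 2"
  obtains \<gamma> t s0 u where "continuous_on {0..} \<gamma>" "quasi_geodesic_on (4 * L) A {0..} \<gamma>"
    "0 \<le> t" "M < t" "\<And>s. s \<le> t \<Longrightarrow> \<gamma> s = \<beta> s" "0 \<le> s0" "0 \<le> u" "\<And>s. 0 \<le> s \<Longrightarrow> \<gamma> (s0 + s) = \<alpha> (u + s)"
proof -
  obtain t u where tu: "0 \<le> t" "M < t" "0 \<le> u"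
    and key: "\<And>t' u'. 0 \<le> t' \<Longrightarrow> t' \<le> t \<Longrightarrow> u \<le> u' \<Longrightarrow>
      dist (\<beta> t) (\<alpha> u) + (t - t') / (4 * L) + (u' - u) / 2 \<le> dist (\<beta> t') (\<alpha> u')"
    using weighted_jump_point[OF a start L A cont qg T u1 early] by blast
  obtain D g where D: "0 \<le> D" and g: "geodesic_on {0..D} g" "g 0 = \<beta> t" "g D = \<alpha> u"
    using geo unfolding geodesic_space_def by blast
  have gd: "dist (g x) (g y) = \<bar>x - y\<bar>" if "x \<in> {0..D}" "y \<in> {0..D}" for x y
    using g(1) that by (simp add: geodesic_on_def)
  have ad: "dist (\<alpha> x) (\<alpha> y) = \<bar>x - y\<bar>" if "0 \<le> x" "0 \<le> y" for x y
    using a that by (simp add: geodesic_on_def)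
  have DD: "dist (\<beta> t) (\<alpha> u) = D" using gd[of 0 D] D g by simp
  define \<gamma> where "\<gamma> s = (if s \<le> t then \<beta> s else if s \<le> t + D then g (s - t) else \<alpha> (u + (s - t - D)))" for s
  have \<gamma>1: "\<gamma> s = \<beta> s" if "s \<le> t" for s using that by (simp add: \<gamma>_def)
  have \<gamma>2: "\<gamma> s = g (s - t)" if "t \<le> s" "s \<le> t + D" for s using that g by (auto simp: \<gamma>_def)
  have \<gamma>3: "\<gamma> s = \<alpha> (u + (s - t - D))" if "t + D \<le> s" for s
    using that g D by (auto simp: \<gamma>_def)
  have "continuous_on {0..} \<gamma>"
  proof -
    have c1: "continuous_on {0..t} \<gamma>"
      by (rule continuous_on_eq[OF continuous_on_subset[OF cont]]) (auto simp: \<gamma>1)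
    have "continuous_on {t..t+D} (\<lambda>s. g (s - t))"
      by (intro continuous_on_compose2[OF geodesic_on_continuous[OF g(1)]] continuous_intros) auto
    then have c2: "continuous_on {t..t+D} \<gamma>" by (rule continuous_on_eq) (auto simp: \<gamma>2)
    have "continuous_on {t+D..} (\<lambda>s. \<alpha> (u + (s - t - D)))"
      using tu by (intro continuous_on_compose2[OF geodesic_on_continuous[OF a]] continuous_intros) auto
    then have c3: "continuous_on {t+D..} \<gamma>" by (rule continuous_on_eq) (auto simp: \<gamma>3)
    have "continuous_on ({0..t} \<union> {t..t+D} \<union> {t+D..}) \<gamma>"
      by (intro continuous_on_closed_Un c1 c2 c3 closed_Un) auto
    moreover have "{0..t} \<union> {t..t+D} \<union> {t+D..} = {0..}" using tu D by auto
    ultimately show ?thesis by simp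
  qed
  moreover have "quasi_geodesic_on (4 * L) A {0..} \<gamma>"
  proof (rule quasi_geodesic_onI)
    fix s s' :: real assume "s \<in> {0..}" "s' \<in> {0..}" and ss: "s \<le> s'"
    then have s0: "0 \<le> s" "0 \<le> s'" by auto
    have LL: "x / (4 * L) \<le> x / 2" "x / (4 * L) \<le> x / L" "x \<le> L * x" "0 \<le> L * x" if "0 \<le> x" for x
    proof -
      show "x / (4 * L) \<le> x / 2" "x / (4 * L) \<le> x / L" using that L by (intro divide_left_mono; simp)+
      show "x \<le> L * x" using mult_right_mono[OF L that] by simp
      show "0 \<le> L * x" using that L by simp
    qed
    have same: "(s' - s) / (4 * L) - A \<le> d \<and> d \<le> 4 * L * (s' - s) + A" if d: "d = s' - s" for d
    proof -
      have "(s' - s) / (4 * L) \<le> (s' - s) / 1" using L ss by (intro divide_left_mono) auto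
      moreover have "1 * (s' - s) \<le> 4 * L * (s' - s)" using L ss by (intro mult_right_mono) auto
      moreover have "X - A \<le> d \<and> d \<le> Y + A" if "X \<le> d / 1" "1 * d \<le> Y" for X Y using that A by simp
      ultimately show ?thesis unfolding d by blast
    qed
    consider (bb) "s' \<le> t" | (bg) "s \<le> t" "t \<le> s'" "s' \<le> t + D" | (ba) "s \<le> t" "t + D \<le> s'"
      | (gg) "t \<le> s" "s' \<le> t + D" | (ga) "t \<le> s" "s \<le> t + D" "t + D \<le> s'" | (aa) "t + D \<le> s"
      using ss by linarith
    then show "(s' - s) / (4 * L) - A \<le> dist (\<gamma> s) (\<gamma> s') \<and> dist (\<gamma> s) (\<gamma> s') \<le> 4 * L * (s' - s) + A"
    proof cases
      case bb
      then show ?thesis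
        using quasi_geodesic_onD[OF qg, of s s'] LL[of "s' - s"] ss s0 \<gamma>1[of s] \<gamma>1[of s'] by simp
    next
      case bg
      have e: "\<gamma> s = \<beta> s" "\<gamma> s' = g (s' - t)" using bg \<gamma>1 \<gamma>2 by auto
      have g1: "dist (\<beta> t) (g (s' - t)) = s' - t" "dist (g (s' - t)) (\<alpha> u) = t + D - s'"
        using gd[of 0 "s' - t"] gd[of "s' - t" D] bg D g by auto
      have "D + (t - s) / (4 * L) \<le> dist (\<beta> s) (\<alpha> u)" using key[of s u] bg s0 DD by simp
      then have "(s' - t) + (t - s) / (4 * L) \<le> dist (\<gamma> s) (\<gamma> s')"
        using g1 dist_triangle[of "\<beta> s" "\<alpha> u" "g (s' - t)"] unfolding e by simp
      moreover have "dist (\<gamma> s) (\<gamma> s') \<le> L * (t - s) + A + (s' - t)"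
        using dist_triangle[of "\<beta> s" "g (s' - t)" "\<beta> t"] quasi_geodesic_onD(2)[OF qg, of s t] g1 bg s0 tu
        unfolding e by simp
      ultimately show ?thesis
        using LL[of "s' - t"] LL[of "t - s"] A bg by (simp add: diff_divide_distrib right_diff_distrib)
    next
      case ba
      define w where "w = s' - t - D"
      have w: "0 \<le> w" "s' = t + D + w" using ba by (auto simp: w_def)
      have e: "\<gamma> s = \<beta> s" "\<gamma> s' = \<alpha> (u + w)" using ba \<gamma>1 \<gamma>3 by (auto simp: w_def)
      have "D + (t - s) / (4 * L) + w / 2 \<le> dist (\<gamma> s) (\<gamma> s')" using key[of s "u + w"] ba s0 DD w unfolding e by simp
      moreover have "dist (\<gamma> s) (\<gamma> s') \<le> L * (t - s) + A + D + w"
        using dist_triangle[of "\<beta> s" "\<alpha> (u + w)" "\<beta> t"] dist_triangle[of "\<beta> t" "\<alpha> (u + w)" "\<alpha> u"]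
          quasi_geodesic_onD(2)[OF qg, of s t] ad[of u "u + w"] DD w ba s0 tu unfolding e by simp
      ultimately show ?thesis
        using LL[of "t - s"] LL[of w] LL[of D] D A ba w(1) unfolding w(2)
        by (simp add: diff_divide_distrib add_divide_distrib right_diff_distrib distrib_left)
    next
      case gg
      then have "dist (\<gamma> s) (\<gamma> s') = s' - s" using gd[of "s - t" "s' - t"] \<gamma>2 ss by simp
      then show ?thesis by (rule same)
    next
      case ga
      define w where "w = s' - t - D"
      define v where "v = t + D - s"
      have w: "0 \<le> w" "0 \<le> v" "s' - s = v + w" using ga by (auto simp: w_def v_def)
      have e: "\<gamma> s = g (s - t)" "\<gamma> s' = \<alpha> (u + w)" using ga \<gamma>2 \<gamma>3 by (auto simp: w_def)
      have g1: "dist (\<beta> t) (g (s - t)) = D - v" "dist (g (s - t)) (\<alpha> u) = v"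
        using gd[of 0 "s - t"] gd[of "s - t" D] ga D g by (auto simp: v_def)
      have "D + w / 2 \<le> dist (\<beta> t) (\<alpha> (u + w))" using key[of t "u + w"] tu DD w by simp
      then have "v + w / 2 \<le> dist (\<gamma> s) (\<gamma> s')"
        using g1 dist_triangle[of "\<beta> t" "\<alpha> (u + w)" "g (s - t)"] unfolding e by simp
      moreover have "dist (\<gamma> s) (\<gamma> s') \<le> v + w"
        using dist_triangle[of "g (s - t)" "\<alpha> (u + w)" "\<alpha> u"] g1 ad[of u "u + w"] w tu unfolding e by simp
      ultimately show ?thesis
        using LL[of v] LL[of w] A w(1,2) unfolding w(3)
        by (simp add: add_divide_distrib distrib_left)
    next
      case aa
      then have "dist (\<gamma> s) (\<gamma> s') = s' - s"
        using ad[of "u + (s - t - D)" "u + (s' - t - D)"] \<gamma>3 ss tu by simp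
      then show ?thesis by (rule same)
    qed
  qed
  moreover have "\<gamma> (t + D + s) = \<alpha> (u + s)" if "0 \<le> s" for s using \<gamma>3[of "t + D + s"] that by simp
  ultimately show thesis using that[of \<gamma> t "t + D" u] tu D \<gamma>1 by simp
qed

section \<open>Rays that end in a tail of a geodesic ray\<close>

lemma closed_quasi_geodesic_ray:
  fixes \<gamma> :: "real \<Rightarrow> 'a::heine_borel"
  assumes L: "1 \<le> L" and cont: "continuous_on {0..} \<gamma>" and qg: "quasi_geodesic_on L A {0..} \<gamma>"
  shows "closed (\<gamma> ` {0..})"
proof -
  have "x \<in> \<gamma> ` {0..}" if x: "x \<in> closure (\<gamma> ` {0..})" for x
  proof -
    \<comment> \<open>Points of the ray within \<open>1\<close> of \<open>x\<close> have parameter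
      at most \<open>S\<close>, so \<open>x\<close> is a limit of a compact piece.\<close>
    define S where "S = L * (dist (\<gamma> 0) x + 1 + A)"
    have "closed (\<gamma> ` {0..S})"
      by (intro compact_imp_closed compact_continuous_image continuous_on_subset[OF cont]) auto
    moreover have "x \<in> closure (\<gamma> ` {0..S})"
      unfolding closure_approachable
    proof (intro allI impI)
      fix e :: real assume "0 < e"
      then have "0 < min e 1" by simp
      then obtain s where s: "0 \<le> s" "dist (\<gamma> s) x < min e 1"
        using x unfolding closure_approachable by (metis (no_types, lifting) atLeast_iff imageE)
      have "s / L - A \<le> dist (\<gamma> 0) (\<gamma> s)" using quasi_geodesic_onD(1)[OF qg, of 0 s] s by simp
      also have "\<dots> \<le> dist (\<gamma> 0) x + 1" using dist_triangle[of "\<gamma> 0" "\<gamma> s" x] s by (simp add: dist_commute)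
      finally have "s \<le> S" using L unfolding S_def by (simp add: pos_divide_le_eq algebra_simps)
      then show "\<exists>y\<in>\<gamma> ` {0..S}. dist y x < e" using s by auto
    qed
    ultimately have "x \<in> \<gamma> ` {0..S}" using closure_closed by blast
    then show ?thesis by auto
  qed
  then show ?thesis using closure_subset_eq by blast
qed

lemma eventually_equal_rays_close:
  assumes qg: "quasi_geodesic_on L A {0..} f" and eq: "\<And>s. 0 \<le> s \<Longrightarrow> f (s0 + s) = g (u + s)"
    and "0 \<le> s0" "0 \<le> u" "1 \<le> L" "0 \<le> A" and x: "x \<in> f ` {0..}"
  shows "\<exists>y\<in>g ` {0..}. dist x y \<le> L * s0 + A"
proof -
  obtain s where s: "0 \<le> s" "x = f s" using x by auto
  show ?thesis
  proof (cases "s \<le> s0")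
    case True
    have "dist (f s) (f s0) \<le> L * (s0 - s) + A" using quasi_geodesic_onD(2)[OF qg, of s s0] s True by simp
    also have "L * (s0 - s) \<le> L * s0" using s assms by (intro mult_left_mono) auto
    finally show ?thesis using eq[of 0] s assms by (intro bexI[of _ "g u"]) auto
  next
    case False
    then have "f s = g (u + (s - s0))" using eq[of "s - s0"] by simp
    then show ?thesis using s assms False by (intro bexI[of _ "f s"]) auto
  qed
qed

text \<open>Outside bounded initial pieces \<gamma> and \<alpha> have the same image. Their images
  thus have finite Hausdorff distance, along which contraction passes to \<gamma>.\<close>

lemma boundary_class_switch:
  fixes bp :: "'a::heine_borel"
  assumes geo: "geodesic_space (UNIV :: 'a set)"
    and z: "\<theta> \<in> contracting_boundary bp" and a: "\<alpha> \<in> \<theta>" "geodesic_on {0..} \<alpha>"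
    and L: "1 \<le> L" and A: "0 \<le> A" and start: "\<gamma> 0 = bp"
    and cont: "continuous_on {0..} \<gamma>" and qg: "quasi_geodesic_on L A {0..} \<gamma>"
    and s0: "0 \<le> s0" and u: "0 \<le> u" and eq: "\<And>s. 0 \<le> s \<Longrightarrow> \<gamma> (s0 + s) = \<alpha> (u + s)"
  shows "\<gamma> \<in> \<theta>"
proof -
  have qa: "quasi_geodesic_on L A {0..} \<alpha>" by (rule geodesic_on_imp_quasi_geodesic_on[OF a(2) L A])
  define C where "C = L * s0 + A + (L * u + A)"
  have C: "L * s0 + A \<le> C" "L * u + A \<le> C" using L A s0 u by (auto simp: C_def)
  have 1: "\<exists>y\<in>\<alpha> ` {0..}. dist x y \<le> C" if "x \<in> \<gamma> ` {0..}" for x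
    using eventually_equal_rays_close[OF qg eq s0 u L A that] C by force
  have 2: "\<exists>y\<in>\<gamma> ` {0..}. dist x y \<le> C" if "x \<in> \<alpha> ` {0..}" for x
    using eventually_equal_rays_close[OF qa eq[symmetric] u s0 L A that] C by force
  have C0: "0 \<le> C" using L A s0 u by (simp add: C_def)
  obtain \<rho> where sub: "sublinear \<rho>" and con: "contracting_with \<rho> (\<alpha> ` {0..})"
    using boundary_class_ray[OF z a(1)] by (auto simp: contracting_rays_def contracting_def)
  have "contracting_with (\<lambda>r. 14 * C + 4 * \<rho> (2 * r + 3 * C)) (\<gamma> ` {0..})"
  proof (rule contracting_with_finite_hausdorff[OF geo con])
    show "mono_on {0..} \<rho>" using sub by (simp add: sublinear_def)
    show "closed (\<gamma> ` {0..})" by (rule closed_quasi_geodesic_ray[OF L cont qg])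
    show "\<exists>x\<in>\<alpha> ` {0..}. dist x y \<le> C" if "y \<in> \<gamma> ` {0..}" for y using 1[OF that] by (simp add: dist_commute)
  qed (use 2 in auto)
  then have "contracting (\<gamma> ` {0..})" using sublinear_rescale[OF sub C0] unfolding contracting_def by blast
  then have "\<gamma> \<in> contracting_rays bp" using start L A qg unfolding contracting_rays_def by blast
  moreover have "finite_hausdorff_dist (\<alpha> ` {0..}) (\<gamma> ` {0..})"
    unfolding finite_hausdorff_dist_def by (rule exI[of _ C]) (use 1 2 in \<open>simp add: dist_commute\<close>)
  ultimately show ?thesis by (rule boundary_class_memI[OF z a(1)])
qed

section \<open>Neighbourhoods\<close>

lemma geodesic_choiceD:
  assumes "geodesic_choice bp \<alpha>" "\<zeta> \<in> contracting_boundary bp"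
  shows "\<alpha> \<zeta> \<in> \<zeta>" "geodesic_on {0..} (\<alpha> \<zeta>)" "\<alpha> \<zeta> 0 = bp"
  using assms boundary_class_origin[OF assms(2)] by (auto simp: geodesic_choice_def)

lemma FQ_nbhd_boundary: "\<eta> \<in> FQ_nbhd bp \<alpha> \<zeta> r \<Longrightarrow> \<eta> \<in> contracting_boundary bp"
  by (simp add: FQ_nbhd_def)

text \<open>The infimum \<open>setdist\<close> need not be attained, whence the summand
  \<open>1\<close>.\<close>

lemma FQ_nbhdE:
  assumes ch: "geodesic_choice bp \<alpha>" and z: "\<zeta> \<in> contracting_boundary bp" and r: "0 \<le> r"
    and eta: "\<eta> \<in> FQ_nbhd bp \<alpha> \<zeta> r"
    and L: "1 \<le> L" and A: "0 \<le> A" and b: "\<beta> \<in> \<eta>" "continuous_on {0..} \<beta>" "quasi_geodesic_on L A {0..} \<beta>"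
  obtains t v where "0 \<le> t" "0 \<le> v" "r \<le> v" "dist (\<beta> t) (\<alpha> \<zeta> v) < kappa (rho_class \<zeta>) L A + 1"
proof -
  note a = geodesic_choiceD[OF ch z]
  let ?Z = "{x \<in> \<alpha> \<zeta> ` {0..}. r \<le> dist x bp}"
  have d: "dist (\<alpha> \<zeta> v) bp = v" if "0 \<le> v" for v using geodesic_ray_dist_origin(2)[OF a(2) that] a(3) by simp
  have "\<alpha> \<zeta> r \<in> ?Z" using d[OF r] r by simp
  then have ne: "?Z \<noteq> {}" by blast
  have "setdist (\<beta> ` {0..}) ?Z < kappa (rho_class \<zeta>) L A + 1"
    using eta L A b unfolding FQ_nbhd_def by fastforce
  moreover have "\<beta> ` {0..} \<noteq> {}" by simp
  ultimately obtain x y where xy: "x \<in> \<beta> ` {0..}" "y \<in> ?Z" "dist x y < kappa (rho_class \<zeta>) L A + 1"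
    using setdist_ltE[OF _ _ ne] by blast
  then obtain t v where "0 \<le> t" "x = \<beta> t" "0 \<le> v" "y = \<alpha> \<zeta> v" by auto
  then show thesis using that[of t v] xy d[of v] by simp
qed

text \<open>
  Only constants up to \<open>r\<close> matter: for larger ones \<open>kappa\<close> is at least \<open>r\<close>, the distance from the
  basepoint to the tail of the geodesic.
\<close>

lemma FQ_nbhdI:
  assumes ch: "geodesic_choice bp \<alpha>" and z: "\<zeta> \<in> contracting_boundary bp" and r: "0 \<le> r"
    and eta: "\<eta> \<in> contracting_boundary bp"
    and close: "\<And>L A \<beta>. 1 \<le> L \<Longrightarrow> L \<le> r \<Longrightarrow> 0 \<le> A \<Longrightarrow> A \<le> r \<Longrightarrow> \<beta> \<in> \<eta> \<Longrightarrow> continuous_on {0..} \<beta> \<Longrightarrow>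
      quasi_geodesic_on L A {0..} \<beta> \<Longrightarrow>
      \<exists>t v. 0 \<le> t \<and> 0 \<le> v \<and> r \<le> v \<and> dist (\<beta> t) (\<alpha> \<zeta> v) \<le> kappa (rho_class \<zeta>) L A"
  shows "\<eta> \<in> FQ_nbhd bp \<alpha> \<zeta> r"
  unfolding FQ_nbhd_def
proof (intro CollectI conjI eta allI impI ballI)
  fix L A :: real and \<beta>
  assume L: "1 \<le> L" and A: "0 \<le> A" and b: "\<beta> \<in> \<eta>" "continuous_on {0..} \<beta> \<and> quasi_geodesic_on L A {0..} \<beta>"
  note a = geodesic_choiceD[OF ch z]
  let ?Z = "{x \<in> \<alpha> \<zeta> ` {0..}. r \<le> dist x bp}"
  have d: "dist (\<alpha> \<zeta> v) bp = v" if "0 \<le> v" for v using geodesic_ray_dist_origin(2)[OF a(2) that] a(3) by simp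
  have "\<exists>t v. 0 \<le> t \<and> 0 \<le> v \<and> r \<le> v \<and> dist (\<beta> t) (\<alpha> \<zeta> v) \<le> kappa (rho_class \<zeta>) L A"
  proof (cases "L \<le> r \<and> A \<le> r")
    case True
    then show ?thesis using close[OF L _ A _ b(1)] b(2) by blast
  next
    case False
    have "1 * L \<le> L * L" using L by (intro mult_right_mono) auto
    then have "r \<le> kappa (rho_class \<zeta>) L A"
      using False kappa_ge(1,2)[of _ "rho_class \<zeta>"] L A r unfolding power2_eq_square by (smt (verit))
    moreover have "dist (\<beta> 0) (\<alpha> \<zeta> r) = r"
      using d[OF r] boundary_class_origin[OF eta b(1)] by (simp add: dist_commute)
    ultimately show ?thesis using r by (intro exI[of _ 0] exI[of _ r]) simp
  qed
  then obtain t v where tv: "0 \<le> t" "0 \<le> v" "r \<le> v" "dist (\<beta> t) (\<alpha> \<zeta> v) \<le> kappa (rho_class \<zeta>) L A" by blast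
  have "setdist (\<beta> ` {0..}) ?Z \<le> dist (\<beta> t) (\<alpha> \<zeta> v)"
    using tv d[of v] by (intro setdist_le_dist) auto
  then show "setdist (\<beta> ` {0..}) ?Z \<le> kappa (rho_class \<zeta>) L A" using tv(4) by linarith
qed

text \<open>
  If \<open>\<beta>\<close> comes near the representative of \<open>\<theta>\<close> very far out, let \<open>\<gamma>\<close> follow \<open>\<beta>\<close> for a long time
  and then switch to that representative. Then \<open>\<gamma> \<in> \<theta>\<close> has to pass near \<open>\<alpha> \<zeta>\<close> beyond \<open>R\<close>; either
  this happens on \<open>\<beta>\<close>, or the whole initial part of \<open>\<gamma>\<close>, including the far point of \<open>\<beta>\<close>, is close
  to \<open>\<alpha> \<zeta>\<close>. So \<open>R\<close> depends on \<open>\<zeta>\<close> and \<open>r\<close> only, and \<open>J\<close> enters only \<open>N\<close>.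
\<close>

lemma FQ_nbhd_transfer:
  fixes bp :: "'a::heine_borel"
  assumes geo: "geodesic_space (UNIV :: 'a set)" and ch: "geodesic_choice bp \<alpha>"
    and z: "\<zeta> \<in> contracting_boundary bp" and r: "1 \<le> r"
  shows "\<exists>R\<ge>1. \<exists>N. \<forall>J \<theta> L A \<beta> T u. \<theta> \<in> FQ_nbhd bp \<alpha> \<zeta> R \<longrightarrow> 1 \<le> L \<longrightarrow> L \<le> r \<longrightarrow> 0 \<le> A \<longrightarrow> A \<le> r \<longrightarrow> \<beta> 0 = bp \<longrightarrow>
      continuous_on {0..} \<beta> \<longrightarrow> quasi_geodesic_on L A {0..} \<beta> \<longrightarrow>
      0 \<le> T \<longrightarrow> 0 \<le> u \<longrightarrow> N J \<le> u \<longrightarrow> dist (\<beta> T) (\<alpha> \<theta> u) \<le> J \<longrightarrow>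
      (\<exists>t v. 0 \<le> t \<and> 0 \<le> v \<and> r \<le> v \<and> dist (\<beta> t) (\<alpha> \<zeta> v) \<le> kappa (rho_class \<zeta>) L A)"
proof -
  note a = geodesic_choiceD[OF ch z]
  let ?\<rho> = "rho_class \<zeta>" and ?Z = "\<alpha> \<zeta> ` {0..}"
  have sub: "sublinear ?\<rho>" and nn: "\<And>s. 0 \<le> s \<Longrightarrow> 0 \<le> ?\<rho> s" using sublinear_rho_class[OF geo z a(1,2)] by auto
  have con: "contracting_with ?\<rho> ?Z" by (rule contracting_with_rho_class[OF z a(1,2)])
  have ne: "?Z \<noteq> {}" and cl: "closed ?Z" using con by (auto simp: contracting_with_def)
  \<comment> \<open>\<open>K1\<close> is the closeness to \<open>\<alpha> \<zeta>\<close> that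
    membership of \<theta> gives for the switched ray, whose constants are at most
    \<open>4 * r\<close> and \<open>r\<close>. \<open>J1\<close> bounds the distance of its initial
    part from \<open>\<alpha> \<zeta>\<close>, and \<open>R\<close> is far enough out for
    \<open>J1\<close>-closeness to improve to \<open>kappa\<close>-closeness beyond
    \<open>r\<close>.\<close>
  define K1 where "K1 = kappa ?\<rho> (4 * r) r + 1"
  define K where "K = kappa ?\<rho> r r"
  have K1: "0 \<le> K1" using kappa_pos[of "4 * r" ?\<rho> r] r by (simp add: K1_def)
  have K0: "0 \<le> K" using kappa_pos[of r ?\<rho> r] r by (simp add: K_def)
  define J1 where "J1 = K1 + r + 3 * (4 * r)\<^sup>2 * (r + 2 * K1)"
  have J1: "K1 \<le> J1" using K1 r by (simp add: J1_def)
  define R where "R = r + J1 + K + r + 3 * r\<^sup>2 * (r + K + J1)"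
  have "0 \<le> 3 * r\<^sup>2 * (r + K + J1)" using r J1 K1 K0 by simp
  then have R: "1 \<le> R" using r J1 K1 K0 unfolding R_def by linarith
  \<comment> \<open>After time \<open>M\<close> the lower bound \<open>t / L - A\<close> places
    \<beta> at least \<open>R + J1\<close> away from the basepoint.\<close>
  define M where "M = r * (R + J1 + r)"
  have M0: "0 \<le> M" using r R J1 K1 by (simp add: M_def)
  have "\<exists>t v. 0 \<le> t \<and> 0 \<le> v \<and> r \<le> v \<and> dist (\<beta> t) (\<alpha> \<zeta> v) \<le> kappa ?\<rho> L A"
    if th: "\<theta> \<in> FQ_nbhd bp \<alpha> \<zeta> R" and L: "1 \<le> L" "L \<le> r" and A: "0 \<le> A" "A \<le> r" and start: "\<beta> 0 = bp"
      and cont: "continuous_on {0..} \<beta>" and qg: "quasi_geodesic_on L A {0..} \<beta>"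
      and T: "0 \<le> T" and u: "0 \<le> u" and N: "5 * J + 3 * r + 2 * r * M + 1 \<le> u" and J: "dist (\<beta> T) (\<alpha> \<theta> u) \<le> J"
    for J \<theta> L A \<beta> T u
  proof -
    have th': "\<theta> \<in> contracting_boundary bp" by (rule FQ_nbhd_boundary[OF th])
    note b = geodesic_choiceD[OF ch th']
    have mono2: "x\<^sup>2 * y \<le> x'\<^sup>2 * y'" if "0 \<le> x" "x \<le> x'" "0 \<le> y" "y \<le> y'" for x x' y y' :: real
      using that by (intro mult_mono power_mono) auto
    have KLA: "0 < kappa ?\<rho> L A" "3 * A \<le> kappa ?\<rho> L A" "kappa ?\<rho> L A \<le> K"
      using kappa_pos[of L ?\<rho> A] kappa_ge(1)[of A ?\<rho> L] kappa_mono[OF sub nn L(1,2) A(2)] L by (auto simp: K_def)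
    have improve: ?thesis if sw: "0 \<le> s" "0 \<le> w" "R \<le> w" "dist (\<beta> s) (\<alpha> \<zeta> w) \<le> J1" for s w
    proof -
      have "L\<^sup>2 * (A + kappa ?\<rho> L A + J1) \<le> r\<^sup>2 * (r + K + J1)"
        using L A KLA J1 K1 by (intro mono2) auto
      then have "r + J1 + kappa ?\<rho> L A + A + 3 * L\<^sup>2 * (A + kappa ?\<rho> L A + J1) \<le> w"
        using sw(3) KLA A(2) unfolding R_def by (simp add: mult.assoc)
      moreover have "\<beta> 0 = \<alpha> \<zeta> 0" using start a(3) by simp
      ultimately obtain t v where "0 \<le> t" "0 \<le> v" "r \<le> v" "dist (\<beta> t) (\<alpha> \<zeta> v) \<le> kappa ?\<rho> L A"
        using quasi_geodesic_close_improve[OF con a(2) L(1) A(1) _ cont qg KLA(1,2)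
            kappa_threshold[OF sub L(1), of A] sw(1,2,4)] by blast
      then show ?thesis by blast
    qed
    have "T / L - A \<le> dist (\<beta> 0) (\<beta> T)" using quasi_geodesic_onD(1)[OF qg, of 0 T] T by simp
    also have "\<dots> \<le> u + J"
      using dist_triangle[of bp "\<beta> T" "\<alpha> \<theta> u"] geodesic_ray_dist_origin(1)[OF b(2) u] b(3) J start
      by (simp add: dist_commute)
    finally have TL: "T / (4 * L) \<le> (u + J + A) / 4" by simp
    have "L * M \<le> r * M" using L M0 by (intro mult_right_mono) auto
    \<comment> \<open>Inserting the bounds on \<open>T\<close> and on the distance, the claim
      reduces to \<open>5 * J + 3 * A + 2 * L * M < u\<close>; this is the origin of the function
      \<open>N\<close>.\<close>
    then have early: "dist (\<beta> T) (\<alpha> \<theta> u) + T / (4 * L) - u / 2 < - (L * M + A) / 2"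
    proof -
      have "d + t - u / 2 < - (x + A) / 2"
        if "x \<le> y" "t \<le> (u + J + A) / 4" "5 * J + 3 * r + 2 * y + 1 \<le> u" "d \<le> J" for d t x y
        using that A r by simp
      moreover have "5 * J + 3 * r + 2 * (r * M) + 1 \<le> u" using N by (simp only: mult.assoc)
      ultimately show ?thesis using \<open>L * M \<le> r * M\<close> TL J by blast
    qed
    have start': "\<beta> 0 = \<alpha> \<theta> 0" using start b(3) by simp
    obtain \<gamma> t s0 w where g: "continuous_on {0..} \<gamma>" "quasi_geodesic_on (4 * L) A {0..} \<gamma>"
      and t: "0 \<le> t" "M < t" "\<And>s. s \<le> t \<Longrightarrow> \<gamma> s = \<beta> s"
      and tail: "0 \<le> s0" "0 \<le> w" "\<And>s. 0 \<le> s \<Longrightarrow> \<gamma> (s0 + s) = \<alpha> \<theta> (w + s)"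
      using quasi_geodesic_switch[OF geo b(2) start' L(1) A(1) cont qg T u early] by blast
    have L4: "1 \<le> 4 * L" using L by simp
    have g0: "\<gamma> 0 = bp" using t(3)[OF t(1)] start by simp
    have "\<gamma> \<in> \<theta>" by (rule boundary_class_switch[OF geo th' b(1,2) L4 A(1) g0 g tail])
    then obtain s v where sv: "0 \<le> s" "0 \<le> v" "R \<le> v" "dist (\<gamma> s) (\<alpha> \<zeta> v) < kappa ?\<rho> (4 * L) A + 1"
      using FQ_nbhdE[OF ch z _ th L4 A(1) _ g] R by (metis order_trans zero_le_one)
    define K2 where "K2 = kappa ?\<rho> (4 * L) A + 1"
    have K2: "0 < K2" "3 * A \<le> K2" "K2 \<le> K1"
      using kappa_pos[OF L4, of ?\<rho> A] kappa_ge(1)[of A ?\<rho> "4 * L"] kappa_mono[OF sub nn L4 _ A(2), of "4 * r"] L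
      by (auto simp: K2_def K1_def)
    have thr: "3 * (4 * L)\<^sup>2 * ?\<rho> x \<le> x" if "K2 \<le> x" for x
      using kappa_threshold[OF sub L4, of A x] that by (simp add: K2_def)
    show ?thesis
    proof (cases "s \<le> t")
      case True
      then show ?thesis using improve[of s v] sv t(3) K2(3) J1 unfolding K2_def by simp
    next
      case False
      have s: "{0..s} \<subseteq> {0..}" by auto
      have "infdist (\<gamma> 0) ?Z = 0" using a(3) g0 by (metis atLeast_iff image_eqI infdist_zero order_refl)
      then have e0: "infdist (\<gamma> 0) ?Z \<le> K2" using K2(1) by simp
      have e1: "infdist (\<gamma> s) ?Z \<le> K2"
        using sv unfolding K2_def by (intro infdist_le2[of "\<alpha> \<zeta> v"]) auto
      have "t \<in> {0..s}" using False t(1) by simp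
      from quasi_geodesic_near_contracting[OF con ne L4 A(1) continuous_on_subset[OF g(1) s]
            quasi_geodesic_on_subset[OF g(2) s] K2(1,2) thr e0 e1 this]
      have "infdist (\<beta> t) ?Z \<le> K2 + A + 3 * ((4 * L)\<^sup>2 * (A + 2 * K2))"
        using t(3)[of t] by (simp add: mult.assoc)
      also have "\<dots> \<le> K1 + r + 3 * ((4 * r)\<^sup>2 * (r + 2 * K1))"
        using L A K2 by (intro add_mono mult_left_mono mono2) auto
      finally have le: "infdist (\<beta> t) ?Z \<le> J1" by (simp add: J1_def mult.assoc)
      obtain q where "q \<in> closest_proj ?Z (\<beta> t)" using closest_proj_nonempty[OF cl ne] .
      then obtain x where x: "0 \<le> x" "dist (\<beta> t) (\<alpha> \<zeta> x) \<le> J1" using le by (auto simp: closest_proj_def)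
      have "L * (R + J1 + r) \<le> M" unfolding M_def using L R J1 K1 r by (intro mult_right_mono) auto
      then have "L * (R + J1 + r) \<le> t" using t(2) by simp
      then have "R + J1 + r \<le> t / L" using L by (simp add: pos_le_divide_eq mult.commute)
      also have "t / L \<le> dist bp (\<beta> t) + r" using quasi_geodesic_onD(1)[OF qg, of 0 t] t(1) start A by simp
      finally have "R \<le> x"
        using geodesic_ray_dist_origin(1)[OF a(2) x(1)] a(3) x(2) dist_triangle[of bp "\<beta> t" "\<alpha> \<zeta> x"]
        by (simp add: dist_commute)
      then show ?thesis using improve[OF t(1) x(1) _ x(2)] by blast
    qed
  qed
  then show ?thesis
    by - (rule exI[of _ R], rule conjI[OF R], rule exI[of _ "\<lambda>J. 5 * J + 3 * r + 2 * r * M + 1"],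
      intro allI impI, blast)
qed

section \<open>Interiors and separation of the sets \<open>FQ_nbhd\<close>\<close>

lemma boundary_class_far_points_close:
  assumes "\<zeta> \<in> contracting_boundary bp" "\<alpha> \<in> \<zeta>" "\<beta> \<in> \<zeta>"
  obtains H where "\<And>v. 0 \<le> v \<Longrightarrow> \<exists>T\<ge>0. dist (\<beta> T) (\<alpha> v) \<le> H"
proof -
  obtain H where "\<forall>y\<in>\<alpha> ` {0..}. \<exists>x\<in>\<beta> ` {0..}. dist x y \<le> H"
    using boundary_class_hausdorff[OF assms(1,3,2)] unfolding finite_hausdorff_dist_def by blast
  then have "\<exists>T\<ge>0. dist (\<beta> T) (\<alpha> v) \<le> H" if "0 \<le> v" for v using that by fastforce
  then show thesis using that by blast
qed

text \<open>Each \<beta> in \<zeta> stays within some \<open>H\<close> of all far points of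
  \<open>\<alpha> \<zeta>\<close>; a point chosen far out in terms of \<open>H\<close> leaves room
  to improve this to \<open>kappa\<close>.\<close>

lemma FQ_nbhd_self:
  fixes bp :: "'a::heine_borel"
  assumes geo: "geodesic_space (UNIV :: 'a set)" and ch: "geodesic_choice bp \<alpha>"
    and z: "\<zeta> \<in> contracting_boundary bp" and r: "1 \<le> r"
  shows "\<zeta> \<in> FQ_nbhd bp \<alpha> \<zeta> r"
proof (rule FQ_nbhdI[OF ch z _ z])
  note a = geodesic_choiceD[OF ch z]
  fix L A :: real and \<beta>
  assume L: "1 \<le> L" and A: "0 \<le> A" and b: "\<beta> \<in> \<zeta>" "continuous_on {0..} \<beta>" "quasi_geodesic_on L A {0..} \<beta>"
  let ?K = "kappa (rho_class \<zeta>) L A"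
  obtain H where H: "\<And>v. 0 \<le> v \<Longrightarrow> \<exists>T\<ge>0. dist (\<beta> T) (\<alpha> \<zeta> v) \<le> H"
    using boundary_class_far_points_close[OF z a(1) b(1)] by blast
  define u where "u = max 0 (r + H + ?K + A + 3 * L\<^sup>2 * (A + ?K + H))"
  have u: "0 \<le> u" "r + H + ?K + A + 3 * L\<^sup>2 * (A + ?K + H) \<le> u" by (auto simp: u_def)
  obtain T where T: "0 \<le> T" "dist (\<beta> T) (\<alpha> \<zeta> u) \<le> H" using H[OF u(1)] by blast
  have start: "\<beta> 0 = \<alpha> \<zeta> 0" using boundary_class_origin[OF z b(1)] a(3) by simp
  have thr: "3 * L\<^sup>2 * rho_class \<zeta> x \<le> x" if "?K \<le> x" for x
    by (rule kappa_threshold[OF sublinear_rho_class(1)[OF geo z a(1,2)] L that])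
  obtain t v where "0 \<le> t" "0 \<le> v" "r \<le> v" "dist (\<beta> t) (\<alpha> \<zeta> v) \<le> ?K"
    using quasi_geodesic_close_improve[OF contracting_with_rho_class[OF z a(1,2)] a(2) L A start b(2,3)
        kappa_pos[OF L] kappa_ge(1) thr T(1) u(1) T(2) u(2)] by blast
  then show "\<exists>t v. 0 \<le> t \<and> 0 \<le> v \<and> r \<le> v \<and> dist (\<beta> t) (\<alpha> \<zeta> v) \<le> ?K" by blast
qed (use r in simp)

text \<open>The transfer is used with \<eta> as intermediate class: a quasi-geodesic in a class near
  \<eta> passes near \<open>\<alpha> \<eta>\<close> far out, hence near
  \<open>\<alpha> \<zeta>\<close>.\<close>

lemma FQ_nbhd_interior:
  fixes bp :: "'a::heine_borel"
  assumes geo: "geodesic_space (UNIV :: 'a set)" and ch: "geodesic_choice bp \<alpha>"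
    and z: "\<zeta> \<in> contracting_boundary bp" and r: "1 \<le> r"
  obtains R where "1 \<le> R" "\<And>\<eta>. \<eta> \<in> FQ_nbhd bp \<alpha> \<zeta> R \<Longrightarrow> \<exists>R'\<ge>1. FQ_nbhd bp \<alpha> \<eta> R' \<subseteq> FQ_nbhd bp \<alpha> \<zeta> r"
proof -
  obtain R N where R: "1 \<le> R" and tr:
    "\<forall>J \<theta> L A \<beta> T u. \<theta> \<in> FQ_nbhd bp \<alpha> \<zeta> R \<longrightarrow> 1 \<le> L \<longrightarrow> L \<le> r \<longrightarrow> 0 \<le> A \<longrightarrow> A \<le> r \<longrightarrow> \<beta> 0 = bp \<longrightarrow>
      continuous_on {0..} \<beta> \<longrightarrow> quasi_geodesic_on L A {0..} \<beta> \<longrightarrow>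
      0 \<le> T \<longrightarrow> 0 \<le> u \<longrightarrow> N J \<le> u \<longrightarrow> dist (\<beta> T) (\<alpha> \<theta> u) \<le> J \<longrightarrow>
      (\<exists>t v. 0 \<le> t \<and> 0 \<le> v \<and> r \<le> v \<and> dist (\<beta> t) (\<alpha> \<zeta> v) \<le> kappa (rho_class \<zeta>) L A)"
    using FQ_nbhd_transfer[OF geo ch z r] by blast
  have "\<exists>R'\<ge>1. FQ_nbhd bp \<alpha> \<eta> R' \<subseteq> FQ_nbhd bp \<alpha> \<zeta> r" if eta: "\<eta> \<in> FQ_nbhd bp \<alpha> \<zeta> R" for \<eta>
  proof -
    have eta': "\<eta> \<in> contracting_boundary bp" by (rule FQ_nbhd_boundary[OF eta])
    note b = geodesic_choiceD[OF ch eta']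
    \<comment> \<open>One \<open>J\<close> for all constants up to \<open>r\<close>, so that the
      radius is fixed before \<open>L\<close>, \<open>A\<close> and \<beta>.\<close>
    define J where "J = kappa (rho_class \<eta>) r r + 1"
    have "FQ_nbhd bp \<alpha> \<eta> (max 1 (N J)) \<subseteq> FQ_nbhd bp \<alpha> \<zeta> r"
    proof
      fix \<xi> assume xi: "\<xi> \<in> FQ_nbhd bp \<alpha> \<eta> (max 1 (N J))"
      have xi': "\<xi> \<in> contracting_boundary bp" by (rule FQ_nbhd_boundary[OF xi])
      show "\<xi> \<in> FQ_nbhd bp \<alpha> \<zeta> r"
      proof (rule FQ_nbhdI[OF ch z _ xi'])
        fix L A :: real and \<beta>
        assume L: "1 \<le> L" "L \<le> r" and A: "0 \<le> A" "A \<le> r"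
          and c: "\<beta> \<in> \<xi>" "continuous_on {0..} \<beta>" "quasi_geodesic_on L A {0..} \<beta>"
        obtain T u where Tu: "0 \<le> T" "0 \<le> u" "max 1 (N J) \<le> u"
          "dist (\<beta> T) (\<alpha> \<eta> u) < kappa (rho_class \<eta>) L A + 1"
          using FQ_nbhdE[OF ch eta' order_trans[OF zero_le_one max.cobounded1] xi L(1) A(1) c] by blast
        have "kappa (rho_class \<eta>) L A \<le> kappa (rho_class \<eta>) r r"
          by (rule kappa_mono[OF sublinear_rho_class[OF geo eta' b(1,2)] L A(2)])
        then have "dist (\<beta> T) (\<alpha> \<eta> u) \<le> J" using Tu(4) by (simp add: J_def)
        moreover have "N J \<le> u" using Tu(3) by simp
        ultimately show "\<exists>t v. 0 \<le> t \<and> 0 \<le> v \<and> r \<le> v \<and> dist (\<beta> t) (\<alpha> \<zeta> v) \<le> kappa (rho_class \<zeta>) L A"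
          using tr[rule_format, OF eta L A boundary_class_origin[OF xi' c(1)] c(2,3) Tu(1,2)] by blast
      qed (use r in simp)
    qed
    then show ?thesis by (intro exI[of _ "max 1 (N J)"]) simp
  qed
  then show thesis using that[OF R] by blast
qed

text \<open>Some \<beta> in \<eta> violates the condition at \<zeta>. For a class \<xi> in both
  sets, \<open>\<alpha> \<xi>\<close> would pass near \<open>\<alpha> \<eta>\<close>, hence near
  \<beta>, far out, and the transfer through \<xi> would give \<beta> that very condition.\<close>

lemma FQ_nbhd_separation:
  fixes bp :: "'a::heine_borel"
  assumes geo: "geodesic_space (UNIV :: 'a set)" and ch: "geodesic_choice bp \<alpha>"
    and z: "\<zeta> \<in> contracting_boundary bp" and r: "1 \<le> r"
  obtains R where "1 \<le> R" "\<And>\<eta>. \<eta> \<in> contracting_boundary bp \<Longrightarrow> \<eta> \<notin> FQ_nbhd bp \<alpha> \<zeta> r \<Longrightarrow>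
    \<exists>R'\<ge>1. FQ_nbhd bp \<alpha> \<eta> R' \<inter> FQ_nbhd bp \<alpha> \<zeta> R = {}"
proof -
  obtain R N where R: "1 \<le> R" and tr:
    "\<forall>J \<theta> L A \<beta> T u. \<theta> \<in> FQ_nbhd bp \<alpha> \<zeta> R \<longrightarrow> 1 \<le> L \<longrightarrow> L \<le> r \<longrightarrow> 0 \<le> A \<longrightarrow> A \<le> r \<longrightarrow> \<beta> 0 = bp \<longrightarrow>
      continuous_on {0..} \<beta> \<longrightarrow> quasi_geodesic_on L A {0..} \<beta> \<longrightarrow>
      0 \<le> T \<longrightarrow> 0 \<le> u \<longrightarrow> N J \<le> u \<longrightarrow> dist (\<beta> T) (\<alpha> \<theta> u) \<le> J \<longrightarrow>
      (\<exists>t v. 0 \<le> t \<and> 0 \<le> v \<and> r \<le> v \<and> dist (\<beta> t) (\<alpha> \<zeta> v) \<le> kappa (rho_class \<zeta>) L A)"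
    using FQ_nbhd_transfer[OF geo ch z r] by blast
  have "\<exists>R'\<ge>1. FQ_nbhd bp \<alpha> \<eta> R' \<inter> FQ_nbhd bp \<alpha> \<zeta> R = {}"
    if eta: "\<eta> \<in> contracting_boundary bp" "\<eta> \<notin> FQ_nbhd bp \<alpha> \<zeta> r" for \<eta>
  proof -
    note b = geodesic_choiceD[OF ch eta(1)]
    have "\<exists>L A \<beta>. 1 \<le> L \<and> L \<le> r \<and> 0 \<le> A \<and> A \<le> r \<and> \<beta> \<in> \<eta> \<and> continuous_on {0..} \<beta> \<and>
        quasi_geodesic_on L A {0..} \<beta> \<and>
        \<not> (\<exists>t v. 0 \<le> t \<and> 0 \<le> v \<and> r \<le> v \<and> dist (\<beta> t) (\<alpha> \<zeta> v) \<le> kappa (rho_class \<zeta>) L A)"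
    proof (rule ccontr)
      assume none: "\<not> ?thesis"
      have "\<eta> \<in> FQ_nbhd bp \<alpha> \<zeta> r"
        by (rule FQ_nbhdI[OF ch z _ eta(1)]) (use r in simp, use none in blast)
      then show False using eta(2) by blast
    qed
    then obtain L A \<beta> where L: "1 \<le> L" "L \<le> r" and A: "0 \<le> A" "A \<le> r"
      and c: "\<beta> \<in> \<eta>" "continuous_on {0..} \<beta>" "quasi_geodesic_on L A {0..} \<beta>"
      and avoid: "\<not> (\<exists>t v. 0 \<le> t \<and> 0 \<le> v \<and> r \<le> v \<and> dist (\<beta> t) (\<alpha> \<zeta> v) \<le> kappa (rho_class \<zeta>) L A)"
      by blast
    obtain H where H: "\<And>v. 0 \<le> v \<Longrightarrow> \<exists>T\<ge>0. dist (\<beta> T) (\<alpha> \<eta> v) \<le> H"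
      using boundary_class_far_points_close[OF eta(1) b(1) c(1)] by blast
    \<comment> \<open>The quasi-geodesic tested in \<xi> is the geodesic
      \<open>\<alpha> \<xi>\<close>, with constants \<open>1\<close> and \<open>0\<close>.\<close>
    define K where "K = kappa (rho_class \<eta>) 1 0 + 1"
    define N' where "N' = N (H + K)"
    have "\<xi> \<notin> FQ_nbhd bp \<alpha> \<zeta> R" if xi: "\<xi> \<in> FQ_nbhd bp \<alpha> \<eta> (max 1 (N' + K))" for \<xi>
    proof
      assume xi2: "\<xi> \<in> FQ_nbhd bp \<alpha> \<zeta> R"
      have xi': "\<xi> \<in> contracting_boundary bp" by (rule FQ_nbhd_boundary[OF xi])
      note d = geodesic_choiceD[OF ch xi']
      have qg: "quasi_geodesic_on 1 0 {0..} (\<alpha> \<xi>)" using geodesic_on_imp_quasi_geodesic_on[OF d(2)] by simp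
      obtain u v where uv: "0 \<le> u" "0 \<le> v" "max 1 (N' + K) \<le> v" "dist (\<alpha> \<xi> u) (\<alpha> \<eta> v) < K"
        using FQ_nbhdE[OF ch eta(1) order_trans[OF zero_le_one max.cobounded1] xi order_refl order_refl
            d(1) geodesic_on_continuous[OF d(2)] qg]
        unfolding K_def by blast
      obtain T where T: "0 \<le> T" "dist (\<beta> T) (\<alpha> \<eta> v) \<le> H" using H[OF uv(2)] by blast
      have "dist (\<beta> T) (\<alpha> \<xi> u) \<le> H + K" using T(2) uv(4) dist_triangle2[of "\<beta> T" "\<alpha> \<xi> u" "\<alpha> \<eta> v"] by linarith
      \<comment> \<open>Comparing distances from the basepoint gives \<open>u \<ge> v - K\<close>;
        the radius \<open>N' + K\<close> allows for this loss.\<close>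
      moreover have "N (H + K) \<le> u"
        using uv dist_triangle[of bp "\<alpha> \<eta> v" "\<alpha> \<xi> u"] geodesic_ray_dist_origin(1)[OF b(2) uv(2)]
          geodesic_ray_dist_origin(1)[OF d(2) uv(1)] b(3) d(3)
        unfolding N'_def by (simp add: dist_commute)
      ultimately show False
        using tr[rule_format, OF xi2 L A boundary_class_origin[OF eta(1) c(1)] c(2,3) T(1) uv(1)] avoid by blast
    qed
    then show ?thesis by (intro exI[of _ "max 1 (N' + K)"]) auto
  qed
  then show thesis using that[OF R] by blast
qed

text \<open>\<open>W\<close> consists of the points having a whole basic set inside
  \<open>FQ_nbhd bp \<alpha> \<zeta> r\<close>. It is open by \<open>FQ_nbhd_interior\<close> and
  lies in that set by \<open>FQ_nbhd_self\<close>.\<close>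

lemma FQ_nbhd_contains_open:
  fixes bp :: "'a::heine_borel"
  assumes geo: "geodesic_space (UNIV :: 'a set)" and ch: "geodesic_choice bp \<alpha>"
    and z: "\<zeta> \<in> contracting_boundary bp" and r: "1 \<le> r"
  obtains W where "openin (FQ_topology bp \<alpha>) W" "\<zeta> \<in> W" "W \<subseteq> FQ_nbhd bp \<alpha> \<zeta> r"
proof -
  define W where "W = {\<eta> \<in> contracting_boundary bp. \<exists>R\<ge>1. FQ_nbhd bp \<alpha> \<eta> R \<subseteq> FQ_nbhd bp \<alpha> \<zeta> r}"
  have "\<exists>s\<ge>1. FQ_nbhd bp \<alpha> \<eta> s \<subseteq> W" if eta: "\<eta> \<in> W" for \<eta>
  proof -
    obtain R where R: "1 \<le> R" "FQ_nbhd bp \<alpha> \<eta> R \<subseteq> FQ_nbhd bp \<alpha> \<zeta> r" and e: "\<eta> \<in> contracting_boundary bp"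
      using eta unfolding W_def by blast
    obtain s where s: "1 \<le> s" "\<And>\<theta>. \<theta> \<in> FQ_nbhd bp \<alpha> \<eta> s \<Longrightarrow> \<exists>R'\<ge>1. FQ_nbhd bp \<alpha> \<theta> R' \<subseteq> FQ_nbhd bp \<alpha> \<eta> R"
      using FQ_nbhd_interior[OF geo ch e R(1)] by blast
    have "FQ_nbhd bp \<alpha> \<eta> s \<subseteq> W"
    proof
      fix \<theta> assume th: "\<theta> \<in> FQ_nbhd bp \<alpha> \<eta> s"
      then show "\<theta> \<in> W" using s(2)[OF th] R(2) FQ_nbhd_boundary[OF th] unfolding W_def by blast
    qed
    then show ?thesis using s(1) by blast
  qed
  then have "openin (FQ_topology bp \<alpha>) W" unfolding openin_FQ_topology[OF ch] W_def by blast
  moreover have "\<zeta> \<in> W" using z r unfolding W_def by blast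
  moreover have "W \<subseteq> FQ_nbhd bp \<alpha> \<zeta> r" unfolding W_def using FQ_nbhd_self[OF geo ch] by blast
  ultimately show thesis using that by blast
qed

section \<open>Regularity\<close>

theorem proposition5p13:
  fixes bp :: "'a::heine_borel"
    and \<alpha> :: "(real \<Rightarrow> 'a) set \<Rightarrow> real \<Rightarrow> 'a"
  assumes "geodesic_space (UNIV :: 'a set)"
    and "geodesic_choice bp \<alpha>"
  shows "regular_space (FQ_topology bp \<alpha>)"
  unfolding regular_space_def
proof (intro allI impI, elim conjE)
  fix C \<zeta> assume C: "closedin (FQ_topology bp \<alpha>) C" and z: "\<zeta> \<in> topspace (FQ_topology bp \<alpha>) - C"
  have top: "topspace (FQ_topology bp \<alpha>) = contracting_boundary bp" by (rule topspace_FQ_topology[OF assms(2)])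
  have zb: "\<zeta> \<in> contracting_boundary bp" using z top by blast
  have "openin (FQ_topology bp \<alpha>) (contracting_boundary bp - C)" using C top by (simp add: closedin_def)
  then obtain r where r: "1 \<le> r" "FQ_nbhd bp \<alpha> \<zeta> r \<subseteq> contracting_boundary bp - C"
    using z top unfolding openin_FQ_topology[OF assms(2)] by blast
  obtain R where R: "1 \<le> R" and sep: "\<And>\<eta>. \<eta> \<in> contracting_boundary bp \<Longrightarrow> \<eta> \<notin> FQ_nbhd bp \<alpha> \<zeta> r \<Longrightarrow>
    \<exists>R'\<ge>1. FQ_nbhd bp \<alpha> \<eta> R' \<inter> FQ_nbhd bp \<alpha> \<zeta> R = {}"
    using FQ_nbhd_separation[OF assms zb r(1)] by blast
  obtain U where U: "openin (FQ_topology bp \<alpha>) U" "\<zeta> \<in> U" "U \<subseteq> FQ_nbhd bp \<alpha> \<zeta> R"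
    using FQ_nbhd_contains_open[OF assms zb R] by blast
  have V: "\<exists>V. openin (FQ_topology bp \<alpha>) V \<and> \<eta> \<in> V \<and> V \<inter> U = {}" if eta: "\<eta> \<in> C" for \<eta>
  proof -
    have e: "\<eta> \<in> contracting_boundary bp" using eta closedin_subset[OF C] top by blast
    have "\<eta> \<notin> FQ_nbhd bp \<alpha> \<zeta> r" using eta r(2) by blast
    then obtain R' where R': "1 \<le> R'" "FQ_nbhd bp \<alpha> \<eta> R' \<inter> FQ_nbhd bp \<alpha> \<zeta> R = {}" using sep[OF e] by blast
    obtain V where "openin (FQ_topology bp \<alpha>) V" "\<eta> \<in> V" "V \<subseteq> FQ_nbhd bp \<alpha> \<eta> R'"
      using FQ_nbhd_contains_open[OF assms e R'(1)] by blast
    then show ?thesis using R'(2) U(3) by blast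
  qed
  \<comment> \<open>The complement of the closure of \<open>U\<close>; it contains \<open>C\<close>
    because every point of \<open>C\<close> has an open neighbourhood missing
    \<open>U\<close>.\<close>
  let ?V = "\<Union>{V. openin (FQ_topology bp \<alpha>) V \<and> V \<inter> U = {}}"
  have "openin (FQ_topology bp \<alpha>) ?V" by (rule openin_Union) simp
  moreover have "C \<subseteq> ?V" using V by blast
  moreover have "disjnt U ?V" unfolding disjnt_def by blast
  ultimately show "\<exists>U V. openin (FQ_topology bp \<alpha>) U \<and> openin (FQ_topology bp \<alpha>) V \<and> \<zeta> \<in> U \<and> C \<subseteq> V \<and> disjnt U V"
    using U(1,2) by blast
qed

end
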